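(* For all partitions $\lambda,\mu$ and all $\beta\in\mathbb C$, $$\Phi^{(\beta)}_{\lambda',\mu'}(y)=(-1)^{|\lambda|+|\mu|}\,\Phi^{(\beta)}_{\mu,\lambda}(-y).$$ In particular, $\Phi^{(\beta)}_{\lambda,\lambda'}(y)$ is an even polynomial in $y$.
   Context: Partitions $\lambda=(\lambda_1\ge\lambda_2\ge\dots)$, $|\lambda|=\sum\lambda_i$, $\ell(\lambda)$ = number of nonzero parts, conjugate partition $\lambda'_i=\#\{j:\lambda_j\ge i\}$. $\boldsymbol\delta_r=(r-1,\dots,1,0)$. Monic Laguerre polynomials $\widehat L_n^{(\beta)}(y)=\sum_{i=0}^n(-1)^{n+i}\binom ni(\beta+i+1)_{n-i}y^i$ with $(z)_m=\prod_{j=0}^{m-1}(z+j)$; $\psi_\pm^{(\beta)}(n,x)=e^{-x^2/2}x^{\frac12\pm\beta}\widehat L_n^{(\pm\beta)}(x^2)$. For strictly decreasing tuples $\boldsymbol m\in\mathbb N^r$, $\boldsymbol n\in\mathbb N^s$, $\Psi^{(\beta)}_{\boldsymbol m,\boldsymbol n}(x)$ is the Wronskian in $x$ of $\psi_+^{(\beta)}(m_1,x),\dots,\psi_+^{(\beta)}(m_r,x),\psi_-^{(\beta)}(n_1,x),\dots,\psi_-^{(\beta)}(n_s,x)$, and $\widetilde\Phi^{(\beta)}_{\boldsymbol m,\boldsymbol n}(y)\in\mathbb Z[\beta,y]$ is the polynomial, monic in $y$, with $\Psi^{(\beta)}_{\boldsymbol m,\boldsymbol n}(x)=\Delta(2\boldsymbol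 m+\beta,2\boldsymbol n-\beta)e^{-\frac12(r+s)x^2}x^{\frac12(r-s)^2+\beta(r-s)}\widetilde\Phi^{(\beta)}_{\boldsymbol m,\boldsymbol n}(x^2)$, where $\Delta(\boldsymbol v)=\prod_{i<j}(v_j-v_i)$. Define $\Phi^{(\beta)}_{\lambda,\mu}(y)=\widetilde\Phi^{(\beta-r+s)}_{\lambda+\boldsymbol\delta_r,\mu+\boldsymbol\delta_s}(y)$ for any $r\ge\ell(\lambda)$, $s\ge\ell(\mu)$ (this is independent of $r,s$); it is monic of degree $|\lambda|+|\mu|$ in $y$. *)

theory Defs
  imports "HOL-Analysis.Complex_Transcendental" "HOL-Computational_Algebra.Polynomial" "Jordan_Normal_Form.Determinant"
begin

definition is_partition :: "nat list \<Rightarrow> bool" where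
  "is_partition la \<longleftrightarrow> sorted_wrt (\<ge>) la \<and> (\<forall>x\<in>set la. 0 < x)"

definition part_size :: "nat list \<Rightarrow> nat" where
  "part_size la = sum_list la"

definition part_conj :: "nat list \<Rightarrow> nat list" where
  "part_conj la = map (\<lambda>i. length (filter (\<lambda>x. Suc i \<le> x) la)) [0..<foldr max la 0]"

definition add_staircase :: "nat list \<Rightarrow> nat list" where
  "add_staircase la = map2 (+) la (rev [0..<length la])"

definition laguerre_hat :: "nat \<Rightarrow> complex \<Rightarrow> complex poly" where
  "laguerre_hat n \<beta> =
     (\<Sum>i\<le>n. monom ((-1) ^ (n + i) * of_nat (n choose i)
                       * pochhammer (\<beta> + of_nat i + 1) (n - i)) i)"

definition psi_plus :: "complex \<Rightarrow> nat \<Rightarrow> complex \<Rightarrow> complex" where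
  "psi_plus \<beta> n x = exp (- x\<^sup>2 / 2) * x powr (1/2 + \<beta>) * poly (laguerre_hat n \<beta>) (x\<^sup>2)"

definition psi_minus :: "complex \<Rightarrow> nat \<Rightarrow> complex \<Rightarrow> complex" where
  "psi_minus \<beta> n x = exp (- x\<^sup>2 / 2) * x powr (1/2 - \<beta>) * poly (laguerre_hat n (- \<beta>)) (x\<^sup>2)"

definition wronskian :: "(complex \<Rightarrow> complex) list \<Rightarrow> complex \<Rightarrow> complex" where
  "wronskian fs x = det (mat (length fs) (length fs) (\<lambda>(i, j). (deriv ^^ i) (fs ! j) x))"

definition Psi :: "complex \<Rightarrow> nat list \<Rightarrow> nat list \<Rightarrow> complex \<Rightarrow> complex" where
  "Psi \<beta> ms ns = wronskian (map (psi_plus \<beta>) ms @ map (psi_minus \<beta>) ns)"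

definition vdm :: "complex list \<Rightarrow> complex" where
  "vdm v = (\<Prod>j<length v. \<Prod>i<j. v ! j - v ! i)"

definition Delta_mn :: "complex \<Rightarrow> nat list \<Rightarrow> nat list \<Rightarrow> complex" where
  "Delta_mn \<beta> ms ns = vdm (map (\<lambda>m. 2 * of_nat m + \<beta>) ms @ map (\<lambda>n. 2 * of_nat n - \<beta>) ns)"

text \<open>The defining relation of the polynomial p = Phi-tilde at parameter beta
  (x ranges over the positive reals, where all the powers are the principal branch).\<close>
definition Phi_tilde_rel :: "nat list \<Rightarrow> nat list \<Rightarrow> complex \<Rightarrow> complex poly \<Rightarrow> bool" where
  "Phi_tilde_rel ms ns \<beta> p \<longleftrightarrow>
     (\<forall>x::real. x > 0 \<longrightarrow>
        Psi \<beta> ms ns (of_real x) =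
          Delta_mn \<beta> ms ns
          * exp (- of_nat (length ms + length ns) * (of_real x)\<^sup>2 / 2)
          * (of_real x) powr (of_int ((int (length ms) - int (length ns))\<^sup>2) / 2
                               + \<beta> * of_int (int (length ms) - int (length ns)))
          * poly p ((of_real x)\<^sup>2))"

text \<open>Phi-tilde as a function of beta: the family of polynomials in y whose coefficients are
  polynomial in beta (i.e. an element of C[beta,y]) and which satisfies the defining relation
  for every beta with Delta nonzero (that is, for all but finitely many beta).\<close>
definition Phi_tilde :: "nat list \<Rightarrow> nat list \<Rightarrow> complex \<Rightarrow> complex poly" where
  "Phi_tilde ms ns = (THE F. (\<forall>k. \<exists>q::complex poly. \<forall>\<beta>. coeff (F \<beta>) k = poly q \<beta>)
                          \<and> (\<forall>\<beta>. Delta_mn \<beta> ms ns \<noteq> 0 \<longrightarrow> Phi_tilde_rel ms ns \<beta> (F \<beta>)))"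

definition Phi :: "nat list \<Rightarrow> nat list \<Rightarrow> complex \<Rightarrow> complex poly" where
  "Phi la mu \<beta> = Phi_tilde (add_staircase la) (add_staircase mu)
                    (\<beta> - of_nat (length la) + of_nat (length mu))"

end

theory Submission
  imports
    "HOL-Complex_Analysis.Cauchy_Integral_Formula"
    Defs
    "HOL-Computational_Algebra.Polynomial_FPS"
begin

text \<open>
  Put \<open>y = x\<^sup>2\<close>, \<open>\<kappa> = (\<beta> / 2)\<^sup>2\<close> and \<open>A = y (d / dy)\<^sup>2 + d / dy - \<kappa> / y\<close>. Up to the common factor
  \<open>exp (- x\<^sup>2 / 2) x\<^sup>1\<^sup>/\<^sup>2\<close>, all the functions \<open>\<psi>\<^sub>\<plusminus>\<close> are of the form \<open>exp (- A) y\<^sup>z\<close>, where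
  \<open>z = m + \<beta> / 2\<close> or \<open>z = n - \<beta> / 2\<close>, and \<open>A y\<^sup>z = (z\<^sup>2 - \<kappa>) y\<^sup>z\<^sup>-\<^sup>1\<close>. Differentiating
  the Wronskian of the functions \<open>exp (- t A) y\<^sup>z\<close> in \<open>t\<close> thus gives a recurrence which lowers one node
  \<open>z\<close> by 1, i.e. removes one box from one of the two partitions. After division by the
  Vandermonde product of the nodes, the coefficients \<open>c\<^sub>k\<close> of \<open>\<Phi>\<close> satisfy
  \<open>k c\<^sub>k(Z) = - \<Sum> w(Z, z) c\<^sub>k\<^sub>-\<^sub>1(Z - {z} \<union> {z - 1})\<close> with explicit rational weights. Conjugating both
  partitions replaces the set of nodes by its reflected complement in a union of two arithmetic progressions;
  telescoping products show that this changes every weight \<open>w\<close> by the factor \<open>-1\<close>. Hence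
  \<open>c\<^sub>k\<close> changes by \<open>(-1)\<^sup>k\<close> for non-integral \<open>\<beta>\<close>, and for all \<open>\<beta>\<close> since the \<open>c\<^sub>k\<close> are polynomials in \<open>\<beta>\<close>.
\<close>


section \<open>Determinants and the Vandermonde product\<close>

text \<open>Repeated synthetic division by the monic factors \<open>X - a l\<close>: the remainder
  at each stage is the next Newton coefficient. Nothing is inverted, so any commutative ring is
  allowed and the nodes may coincide.\<close>

lemma newton_interpolation:
  fixes q :: "'a :: comm_ring_1 poly" and n :: nat
  shows "\<exists>e h. q = (\<Sum>d<n. Polynomial.smult (e d) (\<Prod>l<d. [:- a l, 1:])) + (\<Prod>l<n. [:- a l, 1:]) * h"
proof (induct n)
  case 0
  show ?case by (intro exI[of _ "\<lambda>_. 0"] exI[of _ q]) simp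
next
  case (Suc n)
  then obtain e h where q: "q = (\<Sum>d<n. Polynomial.smult (e d) (\<Prod>l<d. [:- a l, 1:])) + (\<Prod>l<n. [:- a l, 1:]) * h"
    by blast
  let ?P = "\<Prod>l<n. [:- a l, 1:]" and ?h = "synthetic_div h (a n)"
  have "?P * h = ?P * ([:- a n, 1:] * ?h + [:poly h (a n):])"
    by (simp only: synthetic_div_correct')
  also have "\<dots> = Polynomial.smult (poly h (a n)) ?P + ?P * [:- a n, 1:] * ?h"
    by (simp only: distrib_left mult.assoc add.commute) (simp add: mult.commute)
  finally have "q = (\<Sum>d<Suc n. Polynomial.smult ((e(n := poly h (a n))) d) (\<Prod>l<d. [:- a l, 1:]))
      + (\<Prod>l<Suc n. [:- a l, 1:]) * ?h"
    using q by (simp add: add.assoc mult.assoc)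
  then show ?case by blast
qed

definition vandermonde :: "nat \<Rightarrow> (nat \<Rightarrow> 'a :: comm_ring_1) \<Rightarrow> 'a" where
  "vandermonde n z = (\<Prod>j<n. \<Prod>i<j. z j - z i)"

text \<open>Row \<open>j\<close> contains the factor \<open>a j - a j\<close> as soon as
  \<open>d > j\<close>, so the matrix is lower triangular; its diagonal entries are the inner
  products of \<open>vandermonde\<close>.\<close>

lemma det_newton:
  "det (mat n n (\<lambda>(j,d). \<Prod>l<d. a j - a l)) = vandermonde n (a :: nat \<Rightarrow> 'a :: comm_ring_1)"
proof -
  let ?A = "mat n n (\<lambda>(j,d). \<Prod>l<d. a j - a l)"
  have "det ?A = prod_list (diag_mat ?A)"
  proof (rule det_lower_triangular)
    show "?A $$ (i,j) = 0" if "i < j" "j < n" for i j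
      using that by (auto intro!: prod_zero bexI[of _ i])
  qed auto
  also have "\<dots> = vandermonde n a"
    unfolding vandermonde_def diag_mat_def
    by (subst prod.list_conv_set_nth) (auto simp: atLeast0LessThan intro!: prod.cong)
  finally show ?thesis .
qed

text \<open>Expanding every polynomial in the Newton basis of the nodes factors the matrix through the
  triangular one of the previous lemma.\<close>

lemma vandermonde_dvd_det:
  fixes q :: "nat \<Rightarrow> 'a :: comm_ring_1 poly"
  shows "vandermonde n a dvd det (mat n n (\<lambda>(j,p). poly (q p) (a j)))"
proof -
  have "\<forall>p. \<exists>e h. q p = (\<Sum>d<n. Polynomial.smult (e d) (\<Prod>l<d. [:- a l, 1:])) + (\<Prod>l<n. [:- a l, 1:]) * h"
    using newton_interpolation by blast
  then obtain e h where q: "\<And>p. q p = (\<Sum>d<n. Polynomial.smult (e p d) (\<Prod>l<d. [:- a l, 1:]))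
      + (\<Prod>l<n. [:- a l, 1:]) * h p"
    unfolding choice_iff by blast
  have ev: "poly (q p) (a j) = (\<Sum>d<n. (\<Prod>l<d. a j - a l) * e p d)" if "j < n" for p j
  proof -
    have "(\<Prod>l<n. a j - a l) = 0"
      using that by (auto intro!: prod_zero bexI[of _ j])
    then show ?thesis
      using arg_cong[OF q[of p], of "\<lambda>f. poly f (a j)"]
      by (simp add: poly_sum poly_prod mult.commute)
  qed
  have "mat n n (\<lambda>(j,p). poly (q p) (a j))
      = mat n n (\<lambda>(j,d). \<Prod>l<d. a j - a l) * mat n n (\<lambda>(d,p). e p d)"
    by (rule eq_matI) (auto simp: scalar_prod_def ev atLeast0LessThan)
  then have "det (mat n n (\<lambda>(j,p). poly (q p) (a j)))
      = vandermonde n a * det (mat n n (\<lambda>(d,p). e p d))"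
    by (simp add: det_mult[of _ n] det_newton)
  then show ?thesis by simp
qed

text \<open>The monic Newton polynomials \<open>P d\<close> are a unitriangular change of basis from
  the monomials, so the determinant is the one of \<open>det_newton\<close>.\<close>

lemma det_vandermonde:
  fixes a :: "nat \<Rightarrow> 'a :: idom"
  shows "det (mat n n (\<lambda>(j,p). a j ^ p)) = vandermonde n a"
proof -
  define P where "P d = (\<Prod>l<d. [:- a l, 1:])" for d
  have deg: "degree (P d) = d" for d
    unfolding P_def by (subst degree_prod_eq_sum_degree) auto
  have lc: "coeff (P d) d = 1" for d
    using lead_coeff_prod[of "\<lambda>l. [:- a l, 1:]" "{..<d}"] deg[of d] by (simp add: P_def)
  let ?C = "mat n n (\<lambda>(p,d). coeff (P d) p)"
  have ev: "(\<Prod>l<d. a j - a l) = (\<Sum>p<n. a j ^ p * coeff (P d) p)" if "d < n" for j d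
  proof -
    have "(\<Prod>l<d. a j - a l) = poly (P d) (a j)"
      by (simp add: P_def poly_prod)
    also have "\<dots> = (\<Sum>p\<le>d. a j ^ p * coeff (P d) p)"
      by (simp add: poly_altdef deg mult.commute)
    also have "\<dots> = (\<Sum>p<n. a j ^ p * coeff (P d) p)"
      using that by (intro sum.mono_neutral_left) (auto simp: coeff_eq_0 deg)
    finally show ?thesis .
  qed
  have "det ?C = prod_list (diag_mat ?C)"
    by (rule det_upper_triangular[of _ n]) (auto simp: coeff_eq_0 deg)
  also have "\<dots> = 1"
    unfolding diag_mat_def by (subst prod.list_conv_set_nth) (auto simp: lc intro!: prod.neutral)
  finally have C: "det ?C = 1" .
  have "mat n n (\<lambda>(j,d). \<Prod>l<d. a j - a l) = mat n n (\<lambda>(j,p). a j ^ p) * ?C"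
    by (rule eq_matI) (auto simp: scalar_prod_def ev atLeast0LessThan)
  then have "det (mat n n (\<lambda>(j,d). \<Prod>l<d. a j - a l)) = det (mat n n (\<lambda>(j,p). a j ^ p)) * det ?C"
    by (simp add: det_mult[of _ n])
  then show ?thesis by (simp add: C det_newton)
qed

lemma vandermonde_Suc:
  "vandermonde (Suc n) z = vandermonde n z * (\<Prod>i<n. z n - z i)"
  by (simp add: vandermonde_def)

lemma vandermonde_cong:
  "(\<And>i. i < n \<Longrightarrow> z i = z' i) \<Longrightarrow> vandermonde n z = vandermonde n z'"
  unfolding vandermonde_def by (intro prod.cong) auto

lemma vandermonde_nonzero_iff:
  "vandermonde n (z :: nat \<Rightarrow> 'a :: idom) \<noteq> 0 \<longleftrightarrow> inj_on z {..<n}"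
proof -
  have "vandermonde n z = 0 \<longleftrightarrow> (\<exists>j<n. \<exists>i<j. z j = z i)"
    by (auto simp: vandermonde_def)
  also have "\<dots> \<longleftrightarrow> \<not> inj_on z {..<n}"
  proof
    assume "\<not> inj_on z {..<n}"
    then obtain i j where "i < n" "j < n" "z i = z j" "i \<noteq> j"
      by (auto simp: inj_on_def)
    then show "\<exists>j<n. \<exists>i<j. z j = z i"
      by (metis linorder_neqE_nat)
  qed (fastforce simp: inj_on_def)
  finally show ?thesis by blast
qed

text \<open>Only the factors involving node \<open>j\<close> change, and the signs of those with a
  later index cancel between the two sides. The cross-multiplied form avoids division, so repeated
  nodes are covered.\<close>

lemma vandermonde_fun_upd:
  fixes z :: "nat \<Rightarrow> 'a :: comm_ring_1"
  assumes "j < n"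
  shows "vandermonde n (z(j := t)) * (\<Prod>i\<in>{..<n} - {j}. z j - z i)
       = vandermonde n z * (\<Prod>i\<in>{..<n} - {j}. t - z i)"
  using assms
proof (induction n)
  case (Suc n)
  show ?case
  proof (cases "j = n")
    case True
    have "{..<Suc n} - {n} = {..<n}" by auto
    moreover have "vandermonde n (z(n := t)) = vandermonde n z"
      by (rule vandermonde_cong) auto
    ultimately show ?thesis
      by (simp add: True vandermonde_Suc mult_ac del: fun_upd_apply) simp
  next
    case False
    with Suc.prems have j: "j < n" by simp
    have S: "{..<Suc n} - {j} = insert n ({..<n} - {j})" using j by auto
    have split: "(\<Prod>i<n. f i) = f j * (\<Prod>i\<in>{..<n} - {j}. f i)" for f :: "nat \<Rightarrow> 'a"
      using j by (subst prod.remove[of _ j]) auto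
    have "vandermonde (Suc n) (z(j := t)) * (\<Prod>i\<in>{..<Suc n} - {j}. z j - z i)
        = (vandermonde n (z(j := t)) * (\<Prod>i\<in>{..<n} - {j}. z j - z i))
          * ((z n - t) * (z j - z n)) * (\<Prod>i\<in>{..<n} - {j}. z n - z i)"
      unfolding S vandermonde_Suc split using j by (simp add: algebra_simps)
    also have "\<dots> = vandermonde (Suc n) z * (\<Prod>i\<in>{..<Suc n} - {j}. t - z i)"
      unfolding Suc.IH[OF j] S vandermonde_Suc split using j by (simp add: algebra_simps)
    finally show ?thesis .
  qed
qed simp

section \<open>Differentiation of determinants of power series\<close>

lemma fps_deriv_prod:
  "fps_deriv (\<Prod>i\<in>A. f i) = (\<Sum>j\<in>A. fps_deriv (f j) * (\<Prod>i\<in>A - {j}. f i :: 'a :: comm_ring_1 fps))"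
  if "finite A"
  using that
proof (induction A rule: finite_induct)
  case (insert x A)
  have "(\<Prod>i\<in>insert x A - {j}. f i) = f x * (\<Prod>i\<in>A - {j}. f i)" if "j \<in> A" for j
    using that insert by (subst insert_Diff_if) (auto)
  then show ?case using insert
    by (simp add: sum_distrib_left algebra_simps)
qed simp

text \<open>The product rule is applied to each term of the permutation expansion; regrouping by the
  differentiated factor gives one determinant per row.\<close>

lemma fps_deriv_det:
  fixes A :: "nat \<Rightarrow> nat \<Rightarrow> 'a :: comm_ring_1 fps"
  shows "fps_deriv (det (mat n n (\<lambda>(i,p). A i p)))
       = (\<Sum>j<n. det (mat n n (\<lambda>(i,p). if i = j then fps_deriv (A i p) else A i p)))"
proof -
  have s: "fps_deriv (signof p * f) = signof p * fps_deriv f" for p :: "nat \<Rightarrow> nat" and f :: "'a fps"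
    by (cases p rule: sign_cases) simp_all
  have det: "det (mat n n (\<lambda>(i,p). B i p)) = (\<Sum>\<pi> | \<pi> permutes {0..<n}. signof \<pi> * (\<Prod>i<n. B i (\<pi> i)))"
    for B :: "nat \<Rightarrow> nat \<Rightarrow> 'a fps"
    unfolding det_def'[OF mat_carrier] atLeast0LessThan
  proof (intro sum.cong refl arg_cong2[of _ _ _ _ "(*)"] prod.cong)
    fix \<pi> i assume "\<pi> \<in> {\<pi>. \<pi> permutes {..<n}}" "i \<in> {..<n}"
    moreover from this have "\<pi> i \<in> {..<n}"
      by (metis mem_Collect_eq permutes_in_image)
    ultimately show "mat n n (\<lambda>(i,p). B i p) $$ (i, \<pi> i) = B i (\<pi> i)" by simp
  qed
  have "fps_deriv (det (mat n n (\<lambda>(i,p). A i p)))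
      = (\<Sum>\<pi> | \<pi> permutes {0..<n}. signof \<pi> * fps_deriv (\<Prod>i<n. A i (\<pi> i)))"
    by (simp only: det fps_deriv_sum s)
  also have "\<dots> = (\<Sum>\<pi> | \<pi> permutes {0..<n}. \<Sum>j<n. signof \<pi> *
      (\<Prod>i<n. if i = j then fps_deriv (A i (\<pi> i)) else A i (\<pi> i)))"
  proof (intro sum.cong refl)
    fix \<pi>
    have "(\<Prod>i<n. if i = j then fps_deriv (A i (\<pi> i)) else A i (\<pi> i))
        = fps_deriv (A j (\<pi> j)) * (\<Prod>i\<in>{..<n} - {j}. A i (\<pi> i))" if "j < n" for j
      using that by (subst prod.remove[of _ j]) (auto intro!: prod.cong)
    then show "signof \<pi> * fps_deriv (\<Prod>i<n. A i (\<pi> i)) = (\<Sum>j<n. signof \<pi> *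
      (\<Prod>i<n. if i = j then fps_deriv (A i (\<pi> i)) else A i (\<pi> i)))"
      by (simp add: fps_deriv_prod sum_distrib_left)
  qed
  also have "\<dots> = (\<Sum>j<n. \<Sum>\<pi> | \<pi> permutes {0..<n}. signof \<pi> *
      (\<Prod>i<n. if i = j then fps_deriv (A i (\<pi> i)) else A i (\<pi> i)))"
    by (rule sum.swap)
  also have "\<dots> = (\<Sum>j<n. det (mat n n (\<lambda>(i,p). if i = j then fps_deriv (A i p) else A i p)))"
    by (simp only: det)
  finally show ?thesis .
qed

section \<open>The lowering recurrence\<close>

text \<open>These are the coefficients of \<open>exp (- A) y\<^sup>z = (\<Sum>i. lag_coeff \<kappa> z i * y\<^sup>z\<^sup>-\<^sup>i)\<close>, where
  \<open>A y\<^sup>z = (z\<^sup>2 - \<kappa>) y\<^sup>z\<^sup>-\<^sup>1\<close>.\<close>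

definition lag_coeff :: "complex \<Rightarrow> complex \<Rightarrow> nat \<Rightarrow> complex" where
  "lag_coeff \<kappa> z i = (-1) ^ i / fact i * (\<Prod>l<i. (z - of_nat l)\<^sup>2 - \<kappa>)"

text \<open>The \<open>p\<close>-th power of the Euler operator applied to that series, in the variable \<open>1 / y\<close> and
  without the factor \<open>y\<^sup>z\<close>.\<close>

definition lag_fps :: "complex \<Rightarrow> complex \<Rightarrow> nat \<Rightarrow> complex fps" where
  "lag_fps \<kappa> z p = Abs_fps (\<lambda>i. lag_coeff \<kappa> z i * (z - of_nat i) ^ p)"

text \<open>Row \<open>j\<close> lists the Euler iterates of the series attached to node
  \<open>z j\<close>. Up to explicit elementary factors this is the Wronskian, as a series in
  \<open>1 / y\<close>.\<close>

definition lag_det :: "complex \<Rightarrow> nat \<Rightarrow> (nat \<Rightarrow> complex) \<Rightarrow> complex fps" where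
  "lag_det \<kappa> n z = det (mat n n (\<lambda>(j,p). lag_fps \<kappa> (z j) p))"

text \<open>For distinct nodes this is the normalised coefficient of the overview; at repeated nodes
  it is 0, because \<open>x / 0 = 0\<close>.\<close>

definition lag_quot :: "complex \<Rightarrow> nat \<Rightarrow> (nat \<Rightarrow> complex) \<Rightarrow> nat \<Rightarrow> complex" where
  "lag_quot \<kappa> n z k = fps_nth (lag_det \<kappa> n z) k / vandermonde n z"

lemma lag_coeff_Suc:
  "of_nat (Suc i) * lag_coeff \<kappa> z (Suc i) = - (z\<^sup>2 - \<kappa>) * lag_coeff \<kappa> (z - 1) i"
proof -
  have *: "(\<Prod>l<Suc i. (z - of_nat l)\<^sup>2 - \<kappa>) = (z\<^sup>2 - \<kappa>) * (\<Prod>l<i. (z - 1 - of_nat l)\<^sup>2 - \<kappa>)"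
    by (subst prod.lessThan_Suc_shift) (simp add: diff_diff_eq)
  show ?thesis
    unfolding lag_coeff_def * by (simp add: field_simps del: of_nat_Suc)
qed

text \<open>Since \<open>z - Suc i = (z - 1) - i\<close>, lowering the node absorbs the index shift
  in the Euler powers as well as in the coefficients.\<close>

lemma fps_deriv_lag_fps:
  "fps_deriv (lag_fps \<kappa> z p) = fps_const (- (z\<^sup>2 - \<kappa>)) * lag_fps \<kappa> (z - 1) p"
proof (rule fps_ext)
  fix i
  have "fps_nth (fps_deriv (lag_fps \<kappa> z p)) i
      = (of_nat (Suc i) * lag_coeff \<kappa> z (Suc i)) * (z - of_nat (Suc i)) ^ p"
    by (simp add: lag_fps_def mult_ac)
  also have "\<dots> = fps_nth (fps_const (- (z\<^sup>2 - \<kappa>)) * lag_fps \<kappa> (z - 1) p) i"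
    by (simp only: lag_coeff_Suc lag_fps_def) (simp add: diff_diff_eq algebra_simps)
  finally show "fps_nth (fps_deriv (lag_fps \<kappa> z p)) i
      = fps_nth (fps_const (- (z\<^sup>2 - \<kappa>)) * lag_fps \<kappa> (z - 1) p) i" .
qed

lemma det_scale_row:
  assumes "j < n"
  shows "det (mat n n (\<lambda>(i,p). if i = j then c * A i p else A i p))
       = (c :: 'a :: comm_ring_1) * det (mat n n (\<lambda>(i,p). A i p))"
proof -
  have "mat n n (\<lambda>(i,p). if i = j then c * A i p else A i p)
      = multrow j c (mat n n (\<lambda>(i,p). A i p))"
    by (rule eq_matI) auto
  then show ?thesis
    using assms by (simp add: det_multrow[of _ n])
qed

lemma fps_deriv_lag_det:
  "fps_deriv (lag_det \<kappa> n z)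
     = (\<Sum>j<n. fps_const (- ((z j)\<^sup>2 - \<kappa>)) * lag_det \<kappa> n (z(j := z j - 1)))"
  unfolding lag_det_def fps_deriv_det
proof (intro sum.cong refl)
  fix j assume "j \<in> {..<n}"
  have "(\<lambda>(i,p). if i = j then fps_deriv (lag_fps \<kappa> (z i) p) else lag_fps \<kappa> (z i) p)
     = (\<lambda>(i,p). if i = j then fps_const (- ((z j)\<^sup>2 - \<kappa>)) * lag_fps \<kappa> ((z(j := z j - 1)) i) p
          else lag_fps \<kappa> ((z(j := z j - 1)) i) p)"
    by (auto simp: fun_eq_iff fps_deriv_lag_fps)
  then show "det (mat n n (\<lambda>(i,p). if i = j then fps_deriv (lag_fps \<kappa> (z i) p) else lag_fps \<kappa> (z i) p))
     = fps_const (- ((z j)\<^sup>2 - \<kappa>)) * det (mat n n (\<lambda>(i,p). lag_fps \<kappa> ((z(j := z j - 1)) i) p))"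
    using \<open>j \<in> {..<n}\<close> by (simp only: det_scale_row lessThan_iff)
qed

text \<open>Taking constant terms is a ring homomorphism, and the constant term of
  \<open>lag_fps \<kappa> z p\<close> is \<open>z ^ p\<close>.\<close>

lemma lag_det_nth_0: "fps_nth (lag_det \<kappa> n z) 0 = vandermonde n z"
proof -
  interpret h: comm_ring_hom "\<lambda>f :: complex fps. fps_nth f 0"
    by unfold_locales auto
  have "map_mat (\<lambda>f. fps_nth f 0) (mat n n (\<lambda>(j,p). lag_fps \<kappa> (z j) p)) = mat n n (\<lambda>(j,p). z j ^ p)"
    by (rule eq_matI) (auto simp: lag_fps_def lag_coeff_def)
  then show ?thesis
    unfolding lag_det_def by (subst h.hom_det[symmetric]) (simp add: det_vandermonde)
qed

lemma lag_det_eq_0: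
  assumes "\<not> inj_on z {..<n}"
  shows "lag_det \<kappa> n z = 0"
proof -
  obtain i j where ij: "i < n" "j < n" "i \<noteq> j" "z i = z j"
    using assms by (auto simp: inj_on_def)
  show ?thesis
    unfolding lag_det_def
    by (rule det_identical_rows[of _ n i j]) (use ij in \<open>auto intro!: eq_vecI\<close>)
qed

lemma lag_quot_0: "inj_on z {..<n} \<Longrightarrow> lag_quot \<kappa> n z 0 = 1"
  by (simp add: lag_quot_def lag_det_nth_0 vandermonde_nonzero_iff)

lemma lag_det_nth_eq: "fps_nth (lag_det \<kappa> n z) k = lag_quot \<kappa> n z k * vandermonde n z"
  using lag_det_eq_0[of z n \<kappa>] vandermonde_nonzero_iff[of n z] by (cases "inj_on z {..<n}") (auto simp: lag_quot_def)

text \<open>The factor \<open>a^2 - \<kappa>\<close> times the ratio of the Vandermonde products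
  after and before replacing \<open>a\<close> by \<open>a - 1\<close>. It is a function of the set
  of nodes, so that the order of the dual nodes does not matter.\<close>

definition lower_weight :: "complex \<Rightarrow> complex set \<Rightarrow> complex \<Rightarrow> complex" where
  "lower_weight \<kappa> Z a = (a\<^sup>2 - \<kappa>) * (\<Prod>c\<in>Z - {a}. (a - 1 - c) / (a - c))"

text \<open>This is \<open>fps_deriv_lag_det\<close> divided by the Vandermonde product. A term
  drops out when the lowered node hits another one (two equal rows) or its factor
  \<open>(z j)^2 - \<kappa>\<close> vanishes; for beads at a non-integral parameter the removable
  boxes remain.\<close>

lemma lag_quot_Suc:
  assumes inj: "inj_on z {..<n}"
  shows "of_nat (Suc k) * lag_quot \<kappa> n z (Suc k)
       = - (\<Sum>j | j < n \<and> z j - 1 \<notin> z ` {..<n} \<and> (z j)\<^sup>2 \<noteq> \<kappa>.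
              lower_weight \<kappa> (z ` {..<n}) (z j) * lag_quot \<kappa> n (z(j := z j - 1)) k)"
proof -
  let ?Z = "z ` {..<n}"
  have V: "vandermonde n z \<noteq> 0" using inj by (simp add: vandermonde_nonzero_iff)
  have step: "((z j)\<^sup>2 - \<kappa>) * vandermonde n (z(j := z j - 1)) = vandermonde n z * lower_weight \<kappa> ?Z (z j)"
    if "j < n" for j
  proof -
    have P: "(\<Prod>i\<in>{..<n} - {j}. z j - z i) \<noteq> 0"
      using inj that by (auto simp: inj_on_def)
    have im: "?Z - {z j} = z ` ({..<n} - {j})"
      using inj that by (auto simp: inj_on_def)
    have "(\<Prod>c\<in>?Z - {z j}. (z j - 1 - c) / (z j - c)) = (\<Prod>i\<in>{..<n} - {j}. (z j - 1 - z i) / (z j - z i))"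
      unfolding im by (subst prod.reindex) (use inj in \<open>auto intro: inj_on_subset\<close>)
    moreover have "vandermonde n (z(j := z j - 1))
        = vandermonde n z * (\<Prod>i\<in>{..<n} - {j}. (z j - 1 - z i) / (z j - z i))"
      using vandermonde_fun_upd[OF that, of z "z j - 1"] P by (simp add: prod_dividef field_simps)
    ultimately show ?thesis by (simp add: lower_weight_def)
  qed
  have "of_nat (Suc k) * fps_nth (lag_det \<kappa> n z) (Suc k) = fps_nth (fps_deriv (lag_det \<kappa> n z)) k"
    by simp
  also have "\<dots> = - (\<Sum>j<n. ((z j)\<^sup>2 - \<kappa>) * fps_nth (lag_det \<kappa> n (z(j := z j - 1))) k)"
    by (simp add: fps_deriv_lag_det fps_sum_nth sum_negf[symmetric] algebra_simps)
  also have "(\<Sum>j<n. ((z j)\<^sup>2 - \<kappa>) * fps_nth (lag_det \<kappa> n (z(j := z j - 1))) k)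
     = (\<Sum>j | j < n \<and> z j - 1 \<notin> ?Z \<and> (z j)\<^sup>2 \<noteq> \<kappa>. ((z j)\<^sup>2 - \<kappa>) * fps_nth (lag_det \<kappa> n (z(j := z j - 1))) k)"
  proof (intro sum.mono_neutral_right ballI)
    fix j assume "j \<in> {..<n} - {j. j < n \<and> z j - 1 \<notin> ?Z \<and> (z j)\<^sup>2 \<noteq> \<kappa>}"
    then consider "(z j)\<^sup>2 = \<kappa>" | i where "j < n" "i < n" "z j - 1 = z i" by auto
    then show "((z j)\<^sup>2 - \<kappa>) * fps_nth (lag_det \<kappa> n (z(j := z j - 1))) k = 0"
    proof cases
      case 2
      then have "i \<noteq> j" by auto
      with 2 have "\<not> inj_on (z(j := z j - 1)) {..<n}"
        using inj_onD[of "z(j := z j - 1)" "{..<n}" i j] by auto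
      then show ?thesis by (simp add: lag_det_eq_0)
    qed simp
  qed auto
  also have "\<dots> = (\<Sum>j | j < n \<and> z j - 1 \<notin> ?Z \<and> (z j)\<^sup>2 \<noteq> \<kappa>.
      vandermonde n z * (lower_weight \<kappa> ?Z (z j) * lag_quot \<kappa> n (z(j := z j - 1)) k))"
  proof (intro sum.cong refl)
    fix j assume "j \<in> {j. j < n \<and> z j - 1 \<notin> ?Z \<and> (z j)\<^sup>2 \<noteq> \<kappa>}"
    then have "j < n" by simp
    then show "((z j)\<^sup>2 - \<kappa>) * fps_nth (lag_det \<kappa> n (z(j := z j - 1))) k
       = vandermonde n z * (lower_weight \<kappa> ?Z (z j) * lag_quot \<kappa> n (z(j := z j - 1)) k)"
      using arg_cong[OF step[of j], of "\<lambda>x. lag_quot \<kappa> n (z(j := z j - 1)) k * x"]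
      by (simp only: lag_det_nth_eq mult_ac)
  qed
  also have "\<dots> = vandermonde n z * (\<Sum>j | j < n \<and> z j - 1 \<notin> ?Z \<and> (z j)\<^sup>2 \<noteq> \<kappa>.
      lower_weight \<kappa> ?Z (z j) * lag_quot \<kappa> n (z(j := z j - 1)) k)"
    by (simp add: sum_distrib_left)
  finally have "vandermonde n z * (of_nat (Suc k) * lag_quot \<kappa> n z (Suc k))
     = vandermonde n z * - (\<Sum>j | j < n \<and> z j - 1 \<notin> ?Z \<and> (z j)\<^sup>2 \<noteq> \<kappa>.
      lower_weight \<kappa> ?Z (z j) * lag_quot \<kappa> n (z(j := z j - 1)) k)"
    by (simp add: lag_det_nth_eq mult_ac del: of_nat_Suc)
  then show ?thesis
    by (rule mult_left_cancel[OF V, THEN iffD1])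
qed

section \<open>Duality of the coefficients\<close>

definition chain :: "complex \<Rightarrow> nat \<Rightarrow> complex set" where
  "chain e M = (\<lambda>k. e + of_nat k) ` {..<M}"

lemma finite_chain [simp]: "finite (chain e M)"
  by (simp add: chain_def)

text \<open>Each numerator is the denominator of the next factor; \<open>x\<close> being
  non-integral keeps all denominators nonzero.\<close>

lemma prod_chain_outside:
  fixes x :: complex
  assumes "x \<notin> \<int>"
  shows "(\<Prod>k<L. (x - 1 - of_nat k) / (x - of_nat k)) = (x - of_nat L) / x"
proof (induction L)
  case 0
  then show ?case using assms by auto
next
  case (Suc L)
  have "x - of_nat L \<noteq> 0" using assms by (metis Ints_of_nat eq_iff_diff_eq_0)
  then show ?case by (simp only: prod.lessThan_Suc Suc) (simp add: diff_diff_eq add.commute)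
qed

text \<open>The factors \<open>k = m\<close> (zero denominator) and \<open>k = m - 1\<close> (zero
  numerator) are left out; the rest telescopes to \<open>1 / m\<close> below this gap and to
  \<open>M - m\<close> above it.\<close>

lemma prod_chain_inside:
  assumes "0 < m" "m < M"
  shows "(\<Prod>k\<in>{..<M} - {m, m - 1}. (of_nat m - 1 - of_nat k) / (of_nat m - of_nat k))
       = (of_nat M - of_nat m) / (of_nat m :: complex)"
proof -
  let ?f = "\<lambda>k. (of_nat m - 1 - of_nat k) / (of_nat m - of_nat k) :: complex"
  have S: "{..<M} - {m, m - 1} = {..<m - 1} \<union> {m+1..<M}"
    using assms by auto
  have low: "(\<Prod>k<j. ?f k) = (of_nat m - of_nat j) / of_nat m" if "j \<le> m - 1" for j
    using that
  proof (induction j)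
    case (Suc j)
    then have "of_nat m - of_nat j \<noteq> (0 :: complex)"
      using assms by (metis Suc_le_eq diff_le_self eq_iff_diff_eq_0 le_trans nat_less_le of_nat_eq_iff)
    moreover have "(\<Prod>k<j. ?f k) = (of_nat m - of_nat j) / of_nat m" using Suc by simp
    ultimately show ?case by (simp only: prod.lessThan_Suc) (simp add: diff_diff_eq add.commute)
  qed (use assms in auto)
  have high: "(\<Prod>k=m+1..<m+1+j. ?f k) = 1 + of_nat j" for j
  proof (induction j)
    case (Suc j)
    have "of_nat m - of_nat (m + 1 + j) \<noteq> (0 :: complex)"
      by (metis Suc_eq_plus1 add.assoc add.commute add_cancel_left_right add_is_0 eq_iff_diff_eq_0 nat.distinct(1) of_nat_eq_iff)
    then show ?case using Suc by (simp add: divide_simps) (simp add: algebra_simps)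
  qed simp
  have "(\<Prod>k\<in>{..<M} - {m, m - 1}. ?f k) = (\<Prod>k<m - 1. ?f k) * (\<Prod>k=m+1..<M. ?f k)"
    unfolding S by (rule prod.union_disjoint) auto
  also have "(\<Prod>k<m - 1. ?f k) = 1 / of_nat m"
    using low[of "m - 1"] assms by (simp add: of_nat_diff)
  also have "(\<Prod>k=m+1..<M. ?f k) = of_nat M - of_nat m"
    using high[of "M - (m + 1)"] assms by (simp add: of_nat_diff)
  finally show ?thesis by simp
qed

text \<open>The chain of \<open>a\<close> falls under \<open>prod_chain_inside\<close>, the other
  one under \<open>prod_chain_outside\<close>, and the prefactors clear the denominators. For
  \<open>{e1, e2} = {e, - e}\<close> the prefactors multiply to \<open>a^2 - e^2\<close>, as in
  \<open>lower_weight\<close>.\<close>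

lemma prod_two_chains:
  assumes e: "e1 - e2 \<notin> \<int>" and a: "a \<in> chain e1 M" "a - 1 \<in> chain e1 M"
  shows "(a - e1) * (a - e2) * (\<Prod>c\<in>chain e1 M \<union> chain e2 L - {a, a - 1}. (a - 1 - c) / (a - c))
       = - (a - e1 - of_nat M) * (a - e2 - of_nat L)"
proof -
  obtain m where m: "m < M" "a = e1 + of_nat m" using a by (auto simp: chain_def)
  obtain k where k: "k < M" "a - 1 = e1 + of_nat k" using a by (auto simp: chain_def)
  have "of_nat m = (of_nat (Suc k) :: complex)" using m k by (simp add: algebra_simps)
  then have mk: "m = Suc k" by (simp only: of_nat_eq_iff)
  have x: "a - e2 \<notin> \<int>"
  proof
    assume "a - e2 \<in> \<int>"
    then have "a - e2 - of_nat m \<in> \<int>" by (rule Ints_diff) auto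
    then show False using e m by (simp add: algebra_simps)
  qed
  have disj: "chain e1 M \<inter> chain e2 L = {}"
  proof (safe, goal_cases)
    case (1 c)
    from 1(1) obtain i where i: "c = e1 + of_nat i" by (auto simp: chain_def)
    from 1(2) obtain j where j: "c = e2 + of_nat j" by (auto simp: chain_def)
    from i j have "e1 - e2 = of_nat j - of_nat i" by (simp add: algebra_simps)
    then show ?case using e by auto
  qed
  have notin: "a \<notin> chain e2 L" "a - 1 \<notin> chain e2 L" using a disj by auto
  have S: "chain e1 M \<union> chain e2 L - {a, a - 1} = (chain e1 M - {a, a - 1}) \<union> chain e2 L"
    using notin by auto
  have I: "chain e1 M - {a, a - 1} = (\<lambda>k. e1 + of_nat k) ` ({..<M} - {m, m - 1})"
  proof -
    have "{a, a - 1} = (\<lambda>k. e1 + of_nat k) ` {m, m - 1}"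
      using m k mk by simp
    then show ?thesis
      unfolding chain_def by (simp only:) (rule image_set_diff[symmetric], simp add: inj_def)
  qed
  have "(\<Prod>c\<in>chain e1 M \<union> chain e2 L - {a, a - 1}. (a - 1 - c) / (a - c))
     = (\<Prod>c\<in>chain e1 M - {a, a - 1}. (a - 1 - c) / (a - c)) * (\<Prod>c\<in>chain e2 L. (a - 1 - c) / (a - c))"
    unfolding S by (rule prod.union_disjoint) (use disj in auto)
  also have "(\<Prod>c\<in>chain e1 M - {a, a - 1}. (a - 1 - c) / (a - c)) =
      (\<Prod>k\<in>{..<M} - {m, m - 1}. (of_nat m - 1 - of_nat k) / (of_nat m - of_nat k))"
    unfolding I by (subst prod.reindex) (auto simp: m(2) inj_on_def algebra_simps)
  also have "\<dots> = (of_nat M - of_nat m) / of_nat m"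
    by (rule prod_chain_inside) (use m mk in auto)
  also have "(\<Prod>c\<in>chain e2 L. (a - 1 - c) / (a - c))
      = (\<Prod>k<L. (a - e2 - 1 - of_nat k) / (a - e2 - of_nat k))"
    unfolding chain_def by (subst prod.reindex) (auto simp: inj_on_def algebra_simps)
  also have "\<dots> = (a - e2 - of_nat L) / (a - e2)"
    by (rule prod_chain_outside[OF x])
  finally have P: "(\<Prod>c\<in>chain e1 M \<union> chain e2 L - {a, a - 1}. (a - 1 - c) / (a - c))
      = (of_nat M - of_nat m) / of_nat m * ((a - e2 - of_nat L) / (a - e2))" .
  have "a - e2 \<noteq> 0" using x by auto
  moreover have "of_nat m \<noteq> (0 :: complex)" using mk by (simp del: of_nat_Suc)
  moreover have "a - e1 = of_nat m" using m by simp
  moreover have "u * v * ((w - u) / u * (x / v)) = - (u - w) * x" if "u \<noteq> 0" "v \<noteq> 0"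
    for u v w x :: complex
    using that by (simp add: field_simps)
  ultimately show ?thesis unfolding P by (simp only:)
qed

text \<open>Only the first points \<open>- e\<close> and \<open>e\<close> lack a predecessor, as
  non-integral \<open>2 * e\<close> keeps predecessors out of the other chain. Thus the zeros of
  \<open>a^2 - \<kappa>\<close> act as the floor of both chains.\<close>

lemma chain_pred_iff:
  assumes e: "2 * e \<notin> \<int>" and a: "a \<in> chain (- e) M \<union> chain e L"
  shows "a - 1 \<in> chain (- e) M \<union> chain e L \<longleftrightarrow> a\<^sup>2 \<noteq> e\<^sup>2"
proof -
  have sq: "a\<^sup>2 = e\<^sup>2 \<longleftrightarrow> a = e \<or> a = - e" by (rule power2_eq_iff)
  have nn: "of_nat i + 1 \<noteq> (0 :: complex)" for i
    by (metis Suc_eq_plus1 nat.distinct(1) of_nat_1 of_nat_add of_nat_eq_0_iff)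
  have up: "u - 1 \<in> chain u N \<longleftrightarrow> False" for u N
    using nn by (auto simp: chain_def algebra_simps)
  have cross: "u - 1 \<in> chain (- u) N \<longleftrightarrow> False" if "2 * u \<notin> \<int>" for u N
  proof -
    have "u - 1 \<noteq> - u + of_nat k" for k
    proof
      assume "u - 1 = - u + of_nat k"
      then have "2 * u = 1 + of_nat k" by (simp add: algebra_simps)
      then show False using that by auto
    qed
    then show ?thesis by (auto simp: chain_def)
  qed
  have e2: "2 * - e \<notin> \<int>" using e minus_in_Ints_iff[of "2 * e"] by simp
  show ?thesis
  proof
    assume "a - 1 \<in> chain (- e) M \<union> chain e L"
    then show "a\<^sup>2 \<noteq> e\<^sup>2"
      unfolding sq using up cross[OF e] cross[OF e2] by auto
  next
    assume ne: "a\<^sup>2 \<noteq> e\<^sup>2"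
    have down: "a - 1 \<in> chain u N" if u: "a \<in> chain u N" "a \<noteq> u" for u N
    proof -
      obtain k where k: "k < N" "a = u + of_nat k" using u(1) by (auto simp: chain_def)
      with u(2) obtain l where "k = Suc l" by (cases k) auto
      then show ?thesis using k by (auto simp: chain_def)
    qed
    show "a - 1 \<in> chain (- e) M \<union> chain e L"
      using a ne down unfolding sq by auto
  qed
qed

text \<open>The last point \<open>e + (M - 1)\<close> is reflected to the new first point
  \<open>e'\<close>.\<close>

lemma chain_reflect:
  assumes "e' = t - 1 - e - (of_nat M - 1)"
  shows "(\<lambda>a. t - 1 - a) ` chain e M = chain e' M"
proof -
  have "(\<lambda>a. t - 1 - a) ` chain e M = (\<lambda>k. e' + of_nat (M - 1 - k)) ` {..<M}"
    unfolding chain_def image_image by (rule image_cong) (auto simp: assms of_nat_diff algebra_simps)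
  also have "\<dots> = (\<lambda>k. e' + of_nat k) ` (\<lambda>k. M - 1 - k) ` {..<M}"
    by (simp add: image_image)
  also have "(\<lambda>k. M - 1 - k) ` {..<M} = {..<M}"
    by (rule endo_inj_surj) (auto simp: inj_on_def)
  finally show ?thesis by (simp add: chain_def)
qed

lemma fun_upd_image_inj:
  assumes "inj_on z A" "j \<in> A"
  shows "z(j := t) ` A = insert t (z ` A - {z j})"
  using assms by (auto simp: inj_on_def)

text \<open>A node \<open>a\<close> above a gap \<open>a - 1\<close> is paired with the reflected
  gap \<open>t - a\<close>. Reflection inverts each factor over the remaining gaps \<open>G\<close>,
  while nodes and gaps together give the product over \<open>F - {a, a - 1}\<close>, which
  \<open>prod_two_chains\<close> evaluates; the sign comes from there.\<close>

lemma lower_weight_dual: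
  fixes e :: complex
  assumes e: "2 * e \<notin> \<int>"
    and F: "F = chain (- e) M \<union> chain e L" and ZF: "Z \<subseteq> F"
    and t: "t = (of_nat M + of_nat L) / 2" and e': "e' = e + (of_nat L - of_nat M) / 2"
    and a: "a \<in> Z" "a - 1 \<in> F - Z"
  shows "lower_weight (e'\<^sup>2) ((\<lambda>c. t - 1 - c) ` (F - Z)) (t - a) = - lower_weight (e\<^sup>2) Z a"
proof -
  let ?f = "\<lambda>c. (a - 1 - c) / (a - c)"
  define G where "G = F - Z - {a - 1}"
  have fin: "finite F" unfolding F by simp
  have e2: "- e - e \<notin> \<int>" "e - - e \<notin> \<int>"
    using e minus_in_Ints_iff[of "2 * e"] by auto
  have "(\<lambda>c. t - 1 - c) ` (F - Z) - {t - a} = (\<lambda>c. t - 1 - c) ` G"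
    unfolding G_def by (auto simp: algebra_simps)
  then have "(\<Prod>c\<in>(\<lambda>c. t - 1 - c) ` (F - Z) - {t - a}. (t - a - 1 - c) / (t - a - c))
     = (\<Prod>c\<in>(\<lambda>c. t - 1 - c) ` G. (t - a - 1 - c) / (t - a - c))"
    by simp
  also have "\<dots> = (\<Prod>c\<in>G. inverse (?f c))"
  proof (subst prod.reindex, simp add: inj_on_def, rule prod.cong)
    fix c
    show "((\<lambda>c. (t - a - 1 - c) / (t - a - c)) \<circ> (\<lambda>c. t - 1 - c)) c = inverse (?f c)"
    \<comment> \<open>At \<open>c = a - 1\<close>, which is not in \<open>G\<close>, both sides are
      0 by the conventions for division by 0, so the identity holds for every
      \<open>c\<close>.\<close>
    proof (cases "c = a - 1")
      case False
      then have "c + 1 - a \<noteq> 0" "a - 1 - c \<noteq> 0" by (auto simp: algebra_simps)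
      then show ?thesis by (simp add: divide_simps) (simp add: algebra_simps)
    qed simp
  qed simp
  also have "\<dots> = inverse (\<Prod>c\<in>G. ?f c)"
    using prod_inversef[of ?f G] by (simp only: comp_def)
  finally have W': "lower_weight (e'\<^sup>2) ((\<lambda>c. t - 1 - c) ` (F - Z)) (t - a)
      = ((t - a)\<^sup>2 - e'\<^sup>2) * inverse (\<Prod>c\<in>G. ?f c)"
    by (simp add: lower_weight_def)
  have G0: "(\<Prod>c\<in>G. ?f c) \<noteq> 0"
    using fin a unfolding G_def by (auto simp: algebra_simps)
  have "F - {a, a - 1} = (Z - {a}) \<union> G"
    using ZF a unfolding G_def by auto
  then have split: "(\<Prod>c\<in>F - {a, a - 1}. ?f c) = (\<Prod>c\<in>Z - {a}. ?f c) * (\<Prod>c\<in>G. ?f c)"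
    using fin finite_subset[OF ZF fin] by (simp, subst prod.union_disjoint) (auto simp: G_def)
  \<comment> \<open>A node and its predecessor lie in the same chain, since the two chains differ by
    a non-integer.\<close>
  have nomix: False if uv: "u \<in> chain v N" "u - 1 \<in> chain w N'" "v - w \<notin> \<int>" for u v w N N'
  proof -
    obtain i where i: "u = v + of_nat i" using uv(1) by (auto simp: chain_def)
    obtain j where j: "u - 1 = w + of_nat j" using uv(2) by (auto simp: chain_def)
    from i j have "v - w = of_nat j + 1 - of_nat i" by (simp add: algebra_simps)
    then show False using uv(3) by auto
  qed
  have "(a + e) * (a - e) * (\<Prod>c\<in>F - {a, a - 1}. ?f c) = - (a + e - of_nat M) * (a - e - of_nat L)"
  proof (cases "a \<in> chain (- e) M")
    case True
    then have "a - 1 \<in> chain (- e) M" using nomix[OF True, of e L] a e2 F by auto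
    then show ?thesis
      using prod_two_chains[OF e2(1) True, of L] unfolding F by simp
  next
    case False
    then have a1: "a \<in> chain e L" using a ZF F by auto
    then have "a - 1 \<in> chain e L" using nomix[OF a1, of "- e" M] a e2 F by auto
    then show ?thesis
      using prod_two_chains[OF e2(2) a1, of M] unfolding F
      by (simp add: Un_commute mult_ac) (simp add: algebra_simps)
  qed
  \<comment> \<open>The values of \<open>t\<close> and \<open>e'\<close> are chosen so that
    \<open>t - e' = M - e\<close> and \<open>t + e' = L + e\<close>.\<close>
  moreover have "- (a + e - of_nat M) * (a - e - of_nat L) = - ((t - a)\<^sup>2 - e'\<^sup>2)"
    unfolding t e' by (simp add: power2_eq_square field_simps)
  moreover have "a\<^sup>2 - e\<^sup>2 = (a + e) * (a - e)"
    by (simp add: power2_eq_square algebra_simps)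
  ultimately have "(a\<^sup>2 - e\<^sup>2) * ((\<Prod>c\<in>Z - {a}. ?f c) * (\<Prod>c\<in>G. ?f c)) = - ((t - a)\<^sup>2 - e'\<^sup>2)"
    by (simp only: split)
  moreover have "B * inverse Q = - (A * P)" if "A * (P * Q) = - B" "Q \<noteq> 0" for A B P Q :: complex
  proof -
    have "B = - (A * P) * Q" using that(1) by (simp add: mult.assoc)
    then show ?thesis using that(2) by simp
  qed
  ultimately show ?thesis
    using G0 unfolding W' unfolding lower_weight_def by blast
qed

text \<open>Induction on \<open>k\<close> through \<open>lag_quot_Suc\<close>: the movable nodes of
  a configuration and of its reflected complement are in bijection, paired moves keep the
  configurations complementary, and each move contributes one sign.\<close>

lemma lag_quot_dual:
  fixes e :: complex
  assumes e: "2 * e \<notin> \<int>"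
    and F: "F = chain (- e) M \<union> chain e L"
    and t: "t = (of_nat M + of_nat L) / 2" and e': "e' = e + (of_nat L - of_nat M) / 2"
    and inj: "inj_on z {..<n}" and ZF: "z ` {..<n} \<subseteq> F"
    and inj': "inj_on z' {..<n'}" and Z': "z' ` {..<n'} = (\<lambda>c. t - 1 - c) ` (F - z ` {..<n})"
  shows "lag_quot (e'\<^sup>2) n' z' k = (-1) ^ k * lag_quot (e\<^sup>2) n z k"
  using inj ZF inj' Z'
proof (induction k arbitrary: z z')
  case 0
  then show ?case by (simp add: lag_quot_0)
next
  case (Suc k)
  note inj = Suc.prems(1) and ZF = Suc.prems(2) and inj' = Suc.prems(3) and Z' = Suc.prems(4)
  let ?Z = "z ` {..<n}" and ?Z' = "z' ` {..<n'}"
  define F' where "F' = (\<lambda>c. t - 1 - c) ` F"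
  have F': "F' = chain (- e') L \<union> chain e' M"
  proof -
    have "(\<lambda>c. t - 1 - c) ` chain (- e) M = chain e' M"
      by (rule chain_reflect) (simp add: t e' field_simps)
    moreover have "(\<lambda>c. t - 1 - c) ` chain e L = chain (- e') L"
      by (rule chain_reflect) (simp add: t e' field_simps)
    ultimately show ?thesis unfolding F'_def F by (simp add: image_Un Un_commute)
  qed
  have e'2: "2 * e' \<notin> \<int>"
  proof
    assume "2 * e' \<in> \<int>"
    then have "2 * e' - (of_nat L - of_nat M) \<in> \<int>" by (rule Ints_diff) auto
    moreover have "2 * e' - (of_nat L - of_nat M) = 2 * e" by (simp add: e' field_simps)
    ultimately show False using e by simp
  qed
  define J where "J = {j. j < n \<and> z j - 1 \<in> F - ?Z}"
  \<comment> \<open>\<open>z' i\<close> can move when the point below it is a reflected node, hence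
    a gap of the dual configuration; that node is \<open>t - z' i\<close>.\<close>
  define J' where "J' = {i. i < n' \<and> t - z' i \<in> ?Z}"
  have J: "{j. j < n \<and> z j - 1 \<notin> ?Z \<and> (z j)\<^sup>2 \<noteq> e\<^sup>2} = J"
    unfolding J_def using chain_pred_iff[OF e, of _ M L] ZF F by blast
  have refl: "t - 1 - c \<in> (\<lambda>c. t - 1 - c) ` A \<longleftrightarrow> c \<in> A" for c A by auto
  have J': "{i. i < n' \<and> z' i - 1 \<notin> ?Z' \<and> (z' i)\<^sup>2 \<noteq> e'\<^sup>2} = J'"
  proof -
    have "z' i - 1 \<notin> ?Z' \<and> (z' i)\<^sup>2 \<noteq> e'\<^sup>2 \<longleftrightarrow> t - z' i \<in> ?Z" if "i < n'" for i
    proof -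
      have "z' i \<in> F'" using that Z' unfolding F'_def by auto
      then have "(z' i)\<^sup>2 \<noteq> e'\<^sup>2 \<longleftrightarrow> z' i - 1 \<in> F'"
        using chain_pred_iff[OF e'2, of "z' i" L M] F' by simp
      moreover have "t - 1 - (t - z' i) = z' i - 1" by simp
      then have "z' i - 1 \<in> (\<lambda>c. t - 1 - c) ` A \<longleftrightarrow> t - z' i \<in> A" for A
        using refl[of "t - z' i" A] by (simp only:)
      then have "z' i - 1 \<in> F' \<longleftrightarrow> t - z' i \<in> F" "z' i - 1 \<in> ?Z' \<longleftrightarrow> t - z' i \<in> F - ?Z"
        unfolding F'_def Z' by simp_all
      ultimately show ?thesis
        using ZF by auto
    qed
    then show ?thesis unfolding J'_def by auto
  qed
  \<comment> \<open>\<open>h\<close> sends the index of a movable node \<open>a\<close> to the index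
    of its partner \<open>t - a\<close>; \<open>h'\<close> goes back.\<close>
  define h where "h j = inv_into {..<n'} z' (t - z j)" for j
  define h' where "h' i = inv_into {..<n} z (t - z' i)" for i
  have h: "h j < n'" "z' (h j) = t - z j" if "j \<in> J" for j
  proof -
    have "t - 1 - (z j - 1) = t - z j" by simp
    then have "t - z j \<in> ?Z'"
      unfolding Z' using refl[of "z j - 1" "F - ?Z"] that by (simp add: J_def)
    then show "h j < n'" "z' (h j) = t - z j"
      unfolding h_def using inv_into_into[of _ z' "{..<n'}"] f_inv_into_f[of _ z' "{..<n'}"] by auto
  qed
  have h': "h' i < n" "z (h' i) = t - z' i" if "i \<in> J'" for i
    using that inv_into_into[of "t - z' i" z "{..<n}"] f_inv_into_f[of "t - z' i" z "{..<n}"]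
    unfolding h'_def J'_def by auto
  have hJ: "h j \<in> J'" "h' (h j) = j" if "j \<in> J" for j
  proof -
    show "h j \<in> J'" using h[OF that] that by (simp add: J'_def J_def)
    have "z (h' (h j)) = z j" using h'[OF \<open>h j \<in> J'\<close>] h[OF that] by simp
    then show "h' (h j) = j" using inj h'[OF \<open>h j \<in> J'\<close>] that by (auto simp: inj_on_def J_def)
  qed
  have hJ': "h' i \<in> J" "h (h' i) = i" if "i \<in> J'" for i
  proof -
    have "z' i \<in> ?Z'" using that by (simp add: J'_def)
    then obtain c where "c \<in> F - ?Z" "z' i = t - 1 - c" unfolding Z' by blast
    then show "h' i \<in> J" using h'[OF that] by (simp add: J_def)
    have "z' (h (h' i)) = z' i" using h[OF \<open>h' i \<in> J\<close>] h'[OF that] by simp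
    then show "h (h' i) = i" using inj' h[OF \<open>h' i \<in> J\<close>] that by (auto simp: inj_on_def J'_def)
  qed
  have summand: "lower_weight (e'\<^sup>2) ?Z' (z' (h j)) * lag_quot (e'\<^sup>2) n' (z'(h j := z' (h j) - 1)) k
      = (-1) ^ Suc k * (lower_weight (e\<^sup>2) ?Z (z j) * lag_quot (e\<^sup>2) n (z(j := z j - 1)) k)"
    if j: "j \<in> J" for j
  proof -
    let ?a = "z j"
    have jn: "j < n" and a: "?a \<in> ?Z" "?a - 1 \<in> F - ?Z" using j by (auto simp: J_def)
    have w: "lower_weight (e'\<^sup>2) ?Z' (z' (h j)) = - lower_weight (e\<^sup>2) ?Z ?a"
      unfolding Z' h(2)[OF j] by (rule lower_weight_dual[OF e F ZF t e' a])
    have im: "z(j := ?a - 1) ` {..<n} = insert (?a - 1) (?Z - {?a})"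
      by (rule fun_upd_image_inj) (use inj jn in auto)
    have im': "z'(h j := z' (h j) - 1) ` {..<n'} = insert (t - ?a - 1) (?Z' - {t - ?a})"
      by (subst fun_upd_image_inj) (use inj' h[OF j] in auto)
    have "t - ?a - 1 \<notin> ?Z'"
      using refl[of ?a "F - ?Z"] a unfolding Z' by (auto simp: algebra_simps)
    have "lag_quot (e'\<^sup>2) n' (z'(h j := z' (h j) - 1)) k = (-1) ^ k * lag_quot (e\<^sup>2) n (z(j := ?a - 1)) k"
    proof (rule Suc.IH)
      show "inj_on (z(j := ?a - 1)) {..<n}"
        using inj a by (intro inj_on_fun_updI) auto
      show "inj_on (z'(h j := z' (h j) - 1)) {..<n'}"
        using inj' \<open>t - ?a - 1 \<notin> ?Z'\<close> h[OF j] by (intro inj_on_fun_updI) auto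
      show "z(j := ?a - 1) ` {..<n} \<subseteq> F" unfolding im using a ZF by auto
      \<comment> \<open>Moving \<open>?a\<close> down exchanges a node with the gap below it, so the
        complement undergoes the opposite exchange, which reflects to the dual move.\<close>
      have "F - insert (?a - 1) (?Z - {?a}) = insert ?a (F - ?Z - {?a - 1})"
        using a ZF by auto
      then show "z'(h j := z' (h j) - 1) ` {..<n'} = (\<lambda>c. t - 1 - c) ` (F - z(j := ?a - 1) ` {..<n})"
        unfolding im im' Z' by (auto simp: algebra_simps)
    qed
    then show ?thesis unfolding w by simp
  qed
  have "of_nat (Suc k) * lag_quot (e'\<^sup>2) n' z' (Suc k)
      = - (\<Sum>i\<in>J'. lower_weight (e'\<^sup>2) ?Z' (z' i) * lag_quot (e'\<^sup>2) n' (z'(i := z' i - 1)) k)"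
    using lag_quot_Suc[OF inj', of k "e'\<^sup>2"] unfolding J' .
  also have "\<dots> = - (\<Sum>j\<in>J. (-1) ^ Suc k * (lower_weight (e\<^sup>2) ?Z (z j) * lag_quot (e\<^sup>2) n (z(j := z j - 1)) k))"
  proof (rule arg_cong[of _ _ uminus], rule sum.reindex_bij_witness[of _ h h'])
    fix i assume i: "i \<in> J'"
    show "(-1) ^ Suc k * (lower_weight (e\<^sup>2) ?Z (z (h' i)) * lag_quot (e\<^sup>2) n (z(h' i := z (h' i) - 1)) k)
        = lower_weight (e'\<^sup>2) ?Z' (z' i) * lag_quot (e'\<^sup>2) n' (z'(i := z' i - 1)) k"
      using summand[OF hJ'(1)[OF i]] unfolding hJ'(2)[OF i] by (rule sym)
  qed (use hJ hJ' in auto)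
  also have "\<dots> = (-1) ^ Suc k * - (\<Sum>j\<in>J. lower_weight (e\<^sup>2) ?Z (z j) * lag_quot (e\<^sup>2) n (z(j := z j - 1)) k)"
    by (simp add: sum_distrib_left del: power_Suc)
  also have "\<dots> = (-1) ^ Suc k * (of_nat (Suc k) * lag_quot (e\<^sup>2) n z (Suc k))"
    using lag_quot_Suc[OF inj, of k "e\<^sup>2"] unfolding J by simp
  finally have "of_nat (Suc k) * lag_quot (e'\<^sup>2) n' z' (Suc k)
      = of_nat (Suc k) * ((-1) ^ Suc k * lag_quot (e\<^sup>2) n z (Suc k))"
    by (simp only: mult_ac)
  then show ?case
    using mult_left_cancel[of "of_nat (Suc k) :: complex"] of_nat_neq_0 by blast
qed

section \<open>Nodes depending on a parameter\<close>

text \<open>The first \<open>r\<close> nodes belong to \<open>\<psi>\<^sub>+\<close>, the others to \<open>\<psi>\<^sub>-\<close>.\<close>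

definition beads :: "nat \<Rightarrow> (nat \<Rightarrow> nat) \<Rightarrow> complex \<Rightarrow> nat \<Rightarrow> complex" where
  "beads r m b j = of_nat (m j) + (if j < r then b / 2 else - (b / 2))"

text \<open>The largest of \<open>n + 1\<close> distinct naturals is at least \<open>n\<close>;
  induction removes it.\<close>

lemma sum_lessThan_card_le:
  "finite A \<Longrightarrow> \<Sum>{..<card A} \<le> \<Sum>(A :: nat set)"
proof (induction A rule: finite_linorder_max_induct)
  case (insert b A)
  have "A \<subseteq> {..<b}" using insert by auto
  then have "card A \<le> b" using card_mono[of "{..<b}" A] by simp
  moreover have "b \<notin> A" using insert by auto
  ultimately show ?case using insert by simp
qed simp

lemma beads_sum_ge:
  assumes "inj_on (beads r m b) {..<r + s}"
  shows "\<Sum>{..<r} + \<Sum>{..<s} \<le> (\<Sum>j<r + s. m j)"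
proof -
  have i1: "inj_on m {..<r}"
    using assms by (fastforce simp: inj_on_def beads_def)
  have i2: "inj_on m {r..<r + s}"
    using assms by (fastforce simp: inj_on_def beads_def)
  have "\<Sum>{..<r} \<le> (\<Sum>j<r. m j)"
    using sum_lessThan_card_le[of "m ` {..<r}"] i1 by (simp add: card_image sum.reindex)
  moreover have "\<Sum>{..<s} \<le> (\<Sum>j=r..<r + s. m j)"
    using sum_lessThan_card_le[of "m ` {r..<r + s}"] i2 by (simp add: card_image sum.reindex)
  moreover have "(\<Sum>j<r + s. m j) = (\<Sum>j<r. m j) + (\<Sum>j=r..<r + s. m j)"
    by (subst sum.union_disjoint[symmetric]) (auto intro!: sum.cong)
  ultimately show ?thesis by simp
qed

text \<open>Every step of the recurrence lowers the sum of \<open>m\<close> by 1, and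
  \<open>beads_sum_ge\<close> bounds it from below by the staircases. A bead with
  \<open>m j = 0\<close> cannot move because its square is \<open>(b / 2)^2\<close>. This bounds the
  number of coefficients.\<close>

lemma lag_quot_beads_eq_0:
  assumes "inj_on (beads r m b) {..<r + s}"
    and "(\<Sum>j<r + s. m j) < k + \<Sum>{..<r} + \<Sum>{..<s}"
  shows "lag_quot ((b / 2)\<^sup>2) (r + s) (beads r m b) k = 0"
  using assms
proof (induction k arbitrary: m)
  case 0
  then show ?case using beads_sum_ge[of r m b s] by simp
next
  case (Suc k)
  let ?z = "beads r m b" and ?n = "r + s"
  have "lag_quot ((b / 2)\<^sup>2) ?n (?z(j := ?z j - 1)) k = 0"
    if j: "j < ?n" "?z j - 1 \<notin> ?z ` {..<?n}" "(?z j)\<^sup>2 \<noteq> (b / 2)\<^sup>2" for j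
  proof -
    have "m j \<noteq> 0"
    proof
      assume "m j = 0"
      then show False using j(3) by (simp add: beads_def power_divide split: if_splits)
    qed
    then obtain l where l: "m j = Suc l" by (cases "m j") auto
    have z: "?z(j := ?z j - 1) = beads r (m(j := l)) b"
      using l by (auto simp: fun_eq_iff beads_def)
    have "inj_on (?z(j := ?z j - 1)) {..<?n}"
      using Suc.prems(1) j by (intro inj_on_fun_updI) auto
    moreover have "(\<Sum>i<?n. m i) = Suc (\<Sum>i<?n. (m(j := l)) i)"
      using j(1) l by (simp add: sum.remove[of _ j])
    ultimately show ?thesis
      unfolding z by (intro Suc.IH) (use Suc.prems(2) in linarith)+
  qed
  then have "of_nat (Suc k) * lag_quot ((b / 2)\<^sup>2) ?n ?z (Suc k) = 0"
    unfolding lag_quot_Suc[OF Suc.prems(1)] by (simp add: sum.neutral)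
  then show ?case using of_nat_neq_0 mult_eq_0_iff by blast
qed

section \<open>Coefficients as polynomials in the parameter\<close>

lemma fps_const_prod: "fps_const (\<Prod>i\<in>A. f i) = (\<Prod>i\<in>A. fps_const (f i :: 'a :: comm_ring_1))"
  by (induction A rule: infinite_finite_induct) (simp_all flip: fps_const_mult)

text \<open>The outer variable becomes the series variable, and the inner one is evaluated at
  \<open>b\<close>.\<close>

definition specialize :: "complex \<Rightarrow> complex poly poly \<Rightarrow> complex fps" where
  "specialize b f = Abs_fps (\<lambda>k. poly (coeff f k) b)"

lemma specialize_hom: "comm_ring_hom (specialize b)"
proof
  show "specialize b (x * y) = specialize b x * specialize b y" for x y
    by (rule fps_ext) (simp add: specialize_def coeff_mult fps_mult_nth poly_sum atLeast0AtMost)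
qed (auto simp: specialize_def fps_eq_iff)

text \<open>The factor \<open>l = m j\<close> of the product vanishes, so the series of a bead
  terminates.\<close>

lemma lag_coeff_beads_eq_0: "m j < i \<Longrightarrow> lag_coeff ((b / 2)\<^sup>2) (beads r m b j) i = 0"
  by (auto simp: lag_coeff_def beads_def intro!: bexI[of _ "m j"])

text \<open>Treating both the shifts and \<open>b\<close> as indeterminates makes the entries polynomial in the
  nodes, so that the Vandermonde product divides the determinant identically in \<open>b\<close>.\<close>

lemma lag_det_beads_polynomial:
  obtains G :: "nat \<Rightarrow> complex poly"
  where "\<And>b k. fps_nth (lag_det ((b / 2)\<^sup>2) n (beads r m b)) k = poly (G k) b * vandermonde n (beads r m b)"
proof -
  define K where "K = (\<Sum>j<n. m j)"
  define N :: "nat \<Rightarrow> complex poly poly"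
    where "N j = [:[:of_nat (m j), if j < r then 1/2 else - 1/2:]:]" for j
  define \<kappa> :: "complex poly poly" where "\<kappa> = [:[:0, 0, 1/4:]:]"
  define c :: "nat \<Rightarrow> complex poly poly" where "c i = monom [:(-1) ^ i / fact i:] i" for i
  \<comment> \<open>\<open>q p\<close> is the entry of column \<open>p\<close> with the node as
    variable, so all rows evaluate one polynomial. As \<open>K\<close> bounds every
    \<open>m j\<close>, the truncation loses no nonzero coefficient.\<close>
  define q where "q p = (\<Sum>i\<le>K. [:c i:] * (\<Prod>l<i. [:- of_nat l, 1:] ^ 2 - [:\<kappa>:]) * [:- of_nat i, 1:] ^ p)" for p :: nat
  have q: "poly (q p) x = (\<Sum>i\<le>K. c i * (\<Prod>l<i. (x - of_nat l) ^ 2 - \<kappa>) * (x - of_nat i) ^ p)" for p x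
    by (simp add: q_def poly_sum poly_prod mult.assoc)
  have "vandermonde n N dvd det (mat n n (\<lambda>(j,p). poly (q p) (N j)))"
    by (rule vandermonde_dvd_det)
  then obtain g where g: "det (mat n n (\<lambda>(j,p). poly (q p) (N j))) = vandermonde n N * g"
    by (auto simp: dvd_def)
  have main: "fps_nth (lag_det ((b / 2)\<^sup>2) n (beads r m b)) k = poly (coeff g k) b * vandermonde n (beads r m b)" for b k
  proof -
    interpret h: comm_ring_hom "specialize b" by (rule specialize_hom)
    have const: "specialize b [:x:] = fps_const (poly x b)" for x
      by (rule fps_ext) (simp add: specialize_def coeff_pCons split: nat.splits)
    have N: "specialize b (N j) = fps_const (beads r m b j)" for j
      by (simp add: N_def const beads_def)
    have \<kappa>: "specialize b \<kappa> = fps_const ((b / 2)\<^sup>2)"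
      by (simp add: \<kappa>_def const power2_eq_square)
    have of_nat: "specialize b (of_nat i) = fps_const (of_nat i)" for i
      by (simp add: h.hom_of_nat fps_of_nat)
    have c: "specialize b (c i) = fps_const ((-1) ^ i / fact i) * fps_X ^ i" for i
      by (rule fps_ext) (simp add: specialize_def c_def)
    have entry: "specialize b (poly (q p) (N j)) = lag_fps ((b / 2)\<^sup>2) (beads r m b j) p" if "j < n" for j p
    proof -
      have "specialize b (poly (q p) (N j))
          = (\<Sum>i\<le>K. fps_const (lag_coeff ((b / 2)\<^sup>2) (beads r m b j) i * (beads r m b j - of_nat i) ^ p) * fps_X ^ i)"
        unfolding q h.hom_sum h.hom_mult h.hom_prod h.hom_power h.hom_minus N \<kappa> of_nat c lag_coeff_def
        by (simp add: fps_const_prod[symmetric] mult_ac)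
      also have "\<dots> = lag_fps ((b / 2)\<^sup>2) (beads r m b j) p"
      proof (rule fps_ext)
        fix k
        have "m j \<le> K" unfolding K_def using that by (intro member_le_sum) auto
        then have "lag_coeff ((b / 2)\<^sup>2) (beads r m b j) k = 0" if "K < k"
          using that lag_coeff_beads_eq_0[of m j k] by simp
        then show "fps_nth (\<Sum>i\<le>K. fps_const (lag_coeff ((b / 2)\<^sup>2) (beads r m b j) i * (beads r m b j - of_nat i) ^ p) * fps_X ^ i) k
          = fps_nth (lag_fps ((b / 2)\<^sup>2) (beads r m b j) p) k"
          by (auto simp: fps_sum_nth lag_fps_def if_distrib[of "\<lambda>x. _ * x"] not_le cong: if_cong)
      qed
      finally show ?thesis .
    qed
    have "lag_det ((b / 2)\<^sup>2) n (beads r m b) = det (map_mat (specialize b) (mat n n (\<lambda>(j,p). poly (q p) (N j))))"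
      unfolding lag_det_def by (rule arg_cong[of _ _ det], rule eq_matI) (auto simp: entry)
    also have "\<dots> = specialize b (vandermonde n N) * specialize b g"
      by (simp only: h.hom_det g h.hom_mult)
    also have "specialize b (vandermonde n N) = fps_const (vandermonde n (beads r m b))"
      by (simp add: vandermonde_def h.hom_prod h.hom_minus N fps_const_prod[symmetric])
    finally show ?thesis by (simp add: specialize_def)
  qed
  show thesis by (rule that[of "coeff g"]) (rule main)
qed

section \<open>The Wronskian\<close>

text \<open>The coefficient of \<open>H q\<close> in the \<open>p\<close>-th derivative of
  \<open>u * H 0\<close>, for functions with derivative of \<open>H q\<close> equal to
  \<open>2 / x * H (Suc q)\<close>; the second clause is the product rule.\<close>

primrec euler_matrix :: "(complex \<Rightarrow> complex) \<Rightarrow> nat \<Rightarrow> nat \<Rightarrow> complex \<Rightarrow> complex" where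
  "euler_matrix u 0 q = (if q = 0 then u else (\<lambda>_. 0))"
| "euler_matrix u (Suc p) q =
    (\<lambda>x. deriv (euler_matrix u p q) x + (if q = 0 then 0 else euler_matrix u p (q - 1) x * (2 / x)))"

lemma euler_matrix_eq_0: "p < q \<Longrightarrow> euler_matrix u p q = (\<lambda>_. 0)"
  by (induction p arbitrary: q) auto

lemma euler_matrix_diag: "euler_matrix u p p = (\<lambda>x. u x * (2 / x) ^ p)"
  by (induction p) (auto simp: fun_eq_iff euler_matrix_eq_0)

lemma euler_matrix_holomorphic:
  assumes "open S" "0 \<notin> S" "u holomorphic_on S"
  shows "euler_matrix u p q holomorphic_on S"
proof (induction p arbitrary: q)
  case (Suc p)
  have "x \<noteq> 0" if "x \<in> S" for x using that assms by auto
  then show ?case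
    using Suc assms by (cases "q = 0") (auto intro!: holomorphic_intros holomorphic_deriv)
qed (use assms in auto)

text \<open>Derivatives of the columns are expressed by iterates of the Euler operator
  \<open>x / 2 \<cdot> d / dx\<close>, with a triangular matrix not depending on the column.\<close>

lemma deriv_iterate_euler:
  assumes S: "open S" "0 \<notin> S" "u holomorphic_on S"
    and f: "\<And>x. x \<in> S \<Longrightarrow> f x = u x * H 0 x"
    and H: "\<And>q x. x \<in> S \<Longrightarrow> (H q has_field_derivative 2 / x * H (Suc q) x) (at x)"
    and x: "x \<in> S"
  shows "(deriv ^^ p) f x = (\<Sum>q\<le>p. euler_matrix u p q x * H q x)"
  using x
proof (induction p arbitrary: x)
  case 0
  then show ?case by (simp add: f)
next
  case (Suc p)
  let ?M = "euler_matrix u"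
  have M: "(?M p q has_field_derivative deriv (?M p q) x) (at x)" for q
    using euler_matrix_holomorphic[OF S] S(1) Suc.prems by (meson holomorphic_derivI)
  have "((\<lambda>x. \<Sum>q\<le>p. ?M p q x * H q x) has_field_derivative
      (\<Sum>q\<le>p. deriv (?M p q) x * H q x + ?M p q x * (2 / x * H (Suc q) x))) (at x)"
    by (rule DERIV_sum, rule DERIV_cong[OF DERIV_mult[OF M H[OF Suc.prems]]]) (simp add: algebra_simps)
  then have "((deriv ^^ p) f has_field_derivative
      (\<Sum>q\<le>p. deriv (?M p q) x * H q x + ?M p q x * (2 / x * H (Suc q) x))) (at x)"
    by (rule has_field_derivative_transform_within_open[OF _ S(1) Suc.prems]) (simp add: Suc.IH)
  then have "(deriv ^^ Suc p) f x = (\<Sum>q\<le>p. deriv (?M p q) x * H q x + ?M p q x * (2 / x * H (Suc q) x))"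
    by (simp add: DERIV_imp_deriv)
  also have "\<dots> = (\<Sum>q\<le>p. deriv (?M p q) x * H q x) + (\<Sum>q\<le>p. ?M p q x * (2 / x) * H (Suc q) x)"
    by (simp add: sum.distrib mult_ac)
  \<comment> \<open>The entry \<open>q = Suc p\<close> lies above the diagonal and is zero, so both
    sums can be extended to \<open>Suc p\<close>.\<close>
  also have "(\<Sum>q\<le>p. deriv (?M p q) x * H q x) = (\<Sum>q\<le>Suc p. deriv (?M p q) x * H q x)"
    by (simp add: euler_matrix_eq_0)
  also have "(\<Sum>q\<le>p. ?M p q x * (2 / x) * H (Suc q) x)
      = (\<Sum>q\<le>Suc p. (if q = 0 then 0 else ?M p (q - 1) x * (2 / x)) * H q x)"
    by (subst sum.atMost_Suc_shift) simp
  finally show ?case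
    by (simp add: sum.distrib algebra_simps del: sum.atMost_Suc)
qed

text \<open>The triangular matrix contributes its diagonal \<open>u x * (2 / x) ^ p\<close>. The
  transposition arises because the Wronskian has the order of differentiation in its rows and
  \<open>lag_det\<close> has it in its columns.\<close>

lemma det_derivs_euler:
  assumes S: "open S" "0 \<notin> S" "u holomorphic_on S"
    and f: "\<And>j x. j < n \<Longrightarrow> x \<in> S \<Longrightarrow> f j x = u x * H j 0 x"
    and H: "\<And>j q x. j < n \<Longrightarrow> x \<in> S \<Longrightarrow> (H j q has_field_derivative 2 / x * H j (Suc q) x) (at x)"
    and x: "x \<in> S"
  shows "det (mat n n (\<lambda>(p,j). (deriv ^^ p) (f j) x))
       = (\<Prod>p<n. u x * (2 / x) ^ p) * det (mat n n (\<lambda>(j,q). H j q x))"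
proof -
  let ?M = "mat n n (\<lambda>(p,q). euler_matrix u p q x)"
  have ent: "(deriv ^^ p) (f j) x = (\<Sum>q<n. euler_matrix u p q x * H j q x)" if "p < n" "j < n" for p j
  proof -
    have "(deriv ^^ p) (f j) x = (\<Sum>q\<le>p. euler_matrix u p q x * H j q x)"
      by (rule deriv_iterate_euler[OF S _ _ x]) (use that f H in auto)
    also have "\<dots> = (\<Sum>q<n. euler_matrix u p q x * H j q x)"
      using that by (intro sum.mono_neutral_left) (auto simp: euler_matrix_eq_0)
    finally show ?thesis .
  qed
  have "mat n n (\<lambda>(p,j). (deriv ^^ p) (f j) x) = ?M * mat n n (\<lambda>(q,j). H j q x)"
    by (rule eq_matI) (auto simp: scalar_prod_def ent atLeast0LessThan)
  then have "det (mat n n (\<lambda>(p,j). (deriv ^^ p) (f j) x)) = det ?M * det (mat n n (\<lambda>(q,j). H j q x))"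
    by (simp add: det_mult[of _ n])
  also have "det ?M = prod_list (diag_mat ?M)"
    by (rule det_lower_triangular[of n]) (auto simp: euler_matrix_eq_0)
  also have "\<dots> = (\<Prod>p<n. u x * (2 / x) ^ p)"
    unfolding diag_mat_def
    by (subst prod.list_conv_set_nth) (auto simp: atLeast0LessThan euler_matrix_diag intro!: prod.cong)
  also have "mat n n (\<lambda>(q,j). H j q x) = transpose_mat (mat n n (\<lambda>(j,q). H j q x))"
    by (rule eq_matI) auto
  also have "det \<dots> = det (mat n n (\<lambda>(j,q). H j q x))"
    by (rule det_transpose) auto
  finally show ?thesis .
qed

text \<open>Each difference of squares splits as \<open>(m - l) * (m - l + b)\<close>; the first
  factors give \<open>fact i\<close> times the binomial coefficient, the second ones in reverse
  order the Pochhammer symbol.\<close>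

lemma lag_coeff_beads:
  assumes "i \<le> m"
  shows "lag_coeff ((b / 2)\<^sup>2) (of_nat m + b / 2) i
       = (-1) ^ i * of_nat (m choose i) * pochhammer (b + of_nat (m - i) + 1) i"
proof -
  have "(\<Prod>l<i. (of_nat m + b / 2 - of_nat l)\<^sup>2 - (b / 2)\<^sup>2)
      = (\<Prod>l<i. (of_nat m - of_nat l) * (of_nat m - of_nat l + b))"
    by (intro prod.cong refl) (simp add: power2_eq_square field_simps)
  also have "\<dots> = (\<Prod>l<i. of_nat m - of_nat l) * (\<Prod>l<i. of_nat m - of_nat l + b)"
    by (rule prod.distrib)
  also have "(\<Prod>l<i. of_nat m - of_nat l :: complex) = fact i * of_nat (m choose i)"
    by (simp add: binomial_gbinomial gbinomial_prod_rev atLeast0LessThan)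
  also have "(\<Prod>l<i. of_nat m - of_nat l + b) = (\<Prod>l<i. of_nat m - of_nat (i - Suc l) + b)"
    by (rule prod.nat_diff_reindex[symmetric])
  also have "\<dots> = pochhammer (b + of_nat (m - i) + 1) i"
    unfolding pochhammer_prod atLeast0LessThan
    by (intro prod.cong refl) (use assms in \<open>auto simp: of_nat_diff algebra_simps\<close>)
  finally show ?thesis by (simp add: lag_coeff_def)
qed

text \<open>The substitution of \<open>m - i\<close> for \<open>i\<close> passes from ascending to
  descending powers of \<open>x^2\<close>.\<close>

lemma psi_plus_expansion:
  assumes "x \<noteq> 0"
  shows "psi_plus b m x = exp (- x\<^sup>2 / 2) * x powr (1/2)
     * (\<Sum>i\<le>m. lag_coeff ((b / 2)\<^sup>2) (of_nat m + b / 2) i * x powr (2 * (of_nat m + b / 2 - of_nat i)))"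
proof -
  have "poly (laguerre_hat m b) (x\<^sup>2)
      = (\<Sum>i\<le>m. (-1) ^ (m + i) * of_nat (m choose i) * pochhammer (b + of_nat i + 1) (m - i) * (x\<^sup>2) ^ i)"
    by (simp add: laguerre_hat_def poly_sum poly_monom)
  also have "\<dots> = (\<Sum>i\<le>m. lag_coeff ((b / 2)\<^sup>2) (of_nat m + b / 2) i * (x\<^sup>2) ^ (m - i))"
  proof (rule sum.reindex_bij_witness[of _ "\<lambda>i. m - i" "\<lambda>i. m - i"])
    fix i assume "i \<in> {..m}"
    then have i: "i \<le> m" by simp
    then have "(-1 :: complex) ^ (m + i) = (-1) ^ (m - i)"
      by (simp add: minus_one_power_iff)
    then show "lag_coeff ((b / 2)\<^sup>2) (of_nat m + b / 2) (m - i) * (x\<^sup>2) ^ (m - (m - i))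
      = (-1) ^ (m + i) * of_nat (m choose i) * pochhammer (b + of_nat i + 1) (m - i) * (x\<^sup>2) ^ i"
      using i by (subst lag_coeff_beads) (auto simp: binomial_symmetric[of i m])
  qed auto
  finally have L: "poly (laguerre_hat m b) (x\<^sup>2)
      = (\<Sum>i\<le>m. lag_coeff ((b / 2)\<^sup>2) (of_nat m + b / 2) i * (x\<^sup>2) ^ (m - i))" .
  have "x powr b * poly (laguerre_hat m b) (x\<^sup>2) = (\<Sum>i\<le>m. lag_coeff ((b / 2)\<^sup>2) (of_nat m + b / 2) i * x powr (2 * (of_nat m + b / 2 - of_nat i)))"
    unfolding L sum_distrib_left
  proof (intro sum.cong refl)
    fix i assume "i \<in> {..m}"
    then have "2 * (of_nat m + b / 2 - of_nat i) = b + of_nat (2 * (m - i))"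
      by (simp add: of_nat_diff algebra_simps)
    then have "x powr (2 * (of_nat m + b / 2 - of_nat i)) = x powr b * x powr (of_nat (2 * (m - i)))"
      by (simp only: powr_add)
    also have "x powr (of_nat (2 * (m - i))) = (x\<^sup>2) ^ (m - i)"
      using assms by (subst powr_nat') (auto simp: power_mult)
    finally show "x powr b * (lag_coeff ((b / 2)\<^sup>2) (of_nat m + b / 2) i * (x\<^sup>2) ^ (m - i))
      = lag_coeff ((b / 2)\<^sup>2) (of_nat m + b / 2) i * x powr (2 * (of_nat m + b / 2 - of_nat i))"
      by simp
  qed
  then show ?thesis by (simp add: psi_plus_def powr_add mult.assoc)
qed

text \<open>Only \<open>(b / 2)^2\<close> enters the coefficients, so both families share the same
  \<open>\<kappa>\<close>.\<close>

lemma psi_minus_eq: "psi_minus b = psi_plus (- b)"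
  by (simp add: fun_eq_iff psi_minus_def psi_plus_def)

lemma det_scale_rows:
  "det (mat n n (\<lambda>(j,p). c j * A j p)) = (\<Prod>j<n. c j) * det (mat n n (\<lambda>(j,p). A j p :: 'a :: comm_ring_1))"
proof -
  have d: "diag_mat (mat n n (\<lambda>(i,j). if i = j then c i else 0)) = map c [0..<n]"
    by (auto simp: diag_mat_def)
  have "mat n n (\<lambda>(j,p). c j * A j p)
      = mat n n (\<lambda>(i,j). if i = j then c i else 0) * mat n n (\<lambda>(j,p). A j p)"
    by (rule eq_matI) (auto simp: scalar_prod_def if_distrib[of "\<lambda>x. x * _"] cong: if_cong)
  moreover have "det (mat n n (\<lambda>(i,j). if i = j then c i else 0)) = (\<Prod>j<n. c j)"
    by (subst det_lower_triangular[of n]) (auto simp: d prod.list_conv_set_nth atLeast0LessThan)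
  ultimately show ?thesis by (simp add: det_mult[of _ n])
qed

text \<open>The truncation of \<open>lag_fps\<close>, exact for beads; unlike the series it can be
  evaluated at \<open>1 / x^2\<close>.\<close>

definition lag_poly :: "complex \<Rightarrow> complex \<Rightarrow> nat \<Rightarrow> nat \<Rightarrow> complex poly" where
  "lag_poly \<kappa> z m p = (\<Sum>i\<le>m. monom (lag_coeff \<kappa> z i * (z - of_nat i) ^ p) i)"

lemma fps_of_lag_poly:
  "fps_of_poly (lag_poly ((b / 2)\<^sup>2) (beads r m b j) (m j) p) = lag_fps ((b / 2)\<^sup>2) (beads r m b j) p"
  by (rule fps_ext) (auto simp: lag_poly_def lag_fps_def coeff_sum lag_coeff_beads_eq_0 not_le)

lemma lag_det_eq_fps_of_poly:
  "lag_det ((b / 2)\<^sup>2) n (beads r m b)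
     = fps_of_poly (det (mat n n (\<lambda>(j,p). lag_poly ((b / 2)\<^sup>2) (beads r m b j) (m j) p)))"
proof -
  interpret h: comm_ring_hom "fps_of_poly :: complex poly \<Rightarrow> complex fps"
    by unfold_locales (auto simp: fps_of_poly_add fps_of_poly_mult)
  show ?thesis
    unfolding lag_det_def h.hom_det[symmetric]
    by (rule arg_cong[of _ _ det], rule eq_matI) (auto simp: fps_of_lag_poly)
qed

lemma poly_det: "poly (det (mat n n (\<lambda>(j,p). A j p))) w = det (mat n n (\<lambda>(j,p). poly (A j p) (w :: complex)))"
proof -
  interpret h: comm_ring_hom "\<lambda>q. poly q w"
    by unfold_locales auto
  show ?thesis
    unfolding h.hom_det[symmetric]
    by (rule arg_cong[of _ _ det], rule eq_matI) auto
qed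

lemma Psi_eq:
  fixes x :: real and ms ns :: "nat list" and b :: complex
  assumes x: "x > 0"
  defines "n \<equiv> length ms + length ns" and "z \<equiv> beads (length ms) ((!) (ms @ ns)) b"
  shows "Psi b ms ns (of_real x) = (\<Prod>p<n. exp (- (of_real x)\<^sup>2 / 2) * (of_real x) powr (1/2) * (2 / of_real x) ^ p)
     * (\<Prod>j<n. of_real x powr (2 * z j))
     * poly (det (mat n n (\<lambda>(j,p). lag_poly ((b / 2)\<^sup>2) (z j) ((ms @ ns) ! j) p))) (1 / (of_real x)\<^sup>2)"
proof -
  let ?x = "of_real x :: complex" and ?m = "(!) (ms @ ns)" and ?\<kappa> = "(b / 2)\<^sup>2"
  \<comment> \<open>The slit plane, an open neighbourhood of the positive reals on which the
    principal powers are holomorphic.\<close>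
  define S :: "complex set" where "S = - \<real>\<^sub>\<le>\<^sub>0"
  define f where "f j = (map (psi_plus b) ms @ map (psi_minus b) ns) ! j" for j
  define u :: "complex \<Rightarrow> complex" where "u y = exp (- y\<^sup>2 / 2) * y powr (1/2)" for y
  define H where "H j q y = (\<Sum>i\<le>?m j. lag_coeff ?\<kappa> (z j) i * (z j - of_nat i) ^ q * y powr (2 * (z j - of_nat i)))"
    for j q and y :: complex
  have S: "open S" "0 \<notin> S" by (auto simp: S_def closed_nonpos_Reals_complex open_Compl)
  have xS: "?x \<in> S" using x by (auto simp: S_def complex_nonpos_Reals_iff)
  have u: "u holomorphic_on S"
    unfolding u_def S_def by (intro holomorphic_intros) auto
  have fH: "f j y = u y * H j 0 y" if "j < n" "y \<in> S" for j y
  proof -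
    have y: "y \<noteq> 0" using that S by auto
    show ?thesis
    proof (cases "j < length ms")
      case True
      then show ?thesis
        using y by (simp add: f_def nth_append psi_plus_expansion u_def H_def z_def beads_def)
    next
      case False
      then show ?thesis
        using y that psi_plus_expansion[OF y, of "- b" "ns ! (j - length ms)"]
        by (simp add: f_def n_def nth_append psi_minus_eq u_def H_def z_def beads_def)
    qed
  qed
  have H: "(H j q has_field_derivative 2 / y * H j (Suc q) y) (at y)" if "j < n" "y \<in> S" for j q y
  proof -
    have y: "y \<notin> \<real>\<^sub>\<le>\<^sub>0" "y \<noteq> 0" using that S by (auto simp: S_def)
    have p: "((\<lambda>y. y powr a) has_field_derivative a * y powr a / y) (at y)" for a
      using has_field_derivative_powr[OF y(1), of a] y(2) by (simp add: powr_diff)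
    have "((\<lambda>y. \<Sum>i\<le>?m j. lag_coeff ?\<kappa> (z j) i * (z j - of_nat i) ^ q * y powr (2 * (z j - of_nat i)))
      has_field_derivative (\<Sum>i\<le>?m j. lag_coeff ?\<kappa> (z j) i * (z j - of_nat i) ^ q
          * (2 * (z j - of_nat i) * y powr (2 * (z j - of_nat i)) / y))) (at y)"
      by (intro DERIV_sum DERIV_cmult p)
    also have "(\<Sum>i\<le>?m j. lag_coeff ?\<kappa> (z j) i * (z j - of_nat i) ^ q
          * (2 * (z j - of_nat i) * y powr (2 * (z j - of_nat i)) / y)) = 2 / y * H j (Suc q) y"
      unfolding H_def sum_distrib_left by (intro sum.cong refl) (simp add: mult_ac)
    finally show ?thesis unfolding H_def .
  qed
  have Hx: "H j q ?x = ?x powr (2 * z j) * poly (lag_poly ?\<kappa> (z j) (?m j) q) (1 / ?x\<^sup>2)" for j q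
    unfolding H_def lag_poly_def poly_sum poly_monom sum_distrib_left
  proof (intro sum.cong refl)
    fix i
    have "?x powr (2 * (z j - of_nat i)) = ?x powr (2 * z j - of_nat (2 * i))"
      by (simp add: algebra_simps)
    also have "\<dots> = ?x powr (2 * z j) / ?x powr of_nat (2 * i)"
      by (rule powr_diff)
    also have "?x powr of_nat (2 * i) = (?x\<^sup>2) ^ i"
      using x by (subst powr_nat') (auto simp: power_mult)
    finally show "lag_coeff ?\<kappa> (z j) i * (z j - of_nat i) ^ q * ?x powr (2 * (z j - of_nat i))
       = ?x powr (2 * z j) * (lag_coeff ?\<kappa> (z j) i * (z j - of_nat i) ^ q * (1 / ?x\<^sup>2) ^ i)"
      by (simp add: power_one_over field_simps)
  qed
  have "Psi b ms ns ?x = det (mat n n (\<lambda>(p,j). (deriv ^^ p) (f j) ?x))"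
    by (simp add: Psi_def wronskian_def n_def f_def)
  also have "\<dots> = (\<Prod>p<n. u ?x * (2 / ?x) ^ p) * det (mat n n (\<lambda>(j,q). H j q ?x))"
    by (rule det_derivs_euler[OF S u fH H xS])
  also have "det (mat n n (\<lambda>(j,q). H j q ?x))
      = (\<Prod>j<n. ?x powr (2 * z j)) * poly (det (mat n n (\<lambda>(j,p). lag_poly ?\<kappa> (z j) (?m j) p))) (1 / ?x\<^sup>2)"
    by (simp only: Hx det_scale_rows poly_det)
  finally show ?thesis by (simp only: u_def mult.assoc)
qed

section \<open>Explicit description of \<open>Phi_tilde\<close>\<close>

lemma of_nat_sum_lessThan: "of_nat (\<Sum>{..<n}) = (of_nat n * (of_nat n - 1) / 2 :: complex)"
  by (induction n) (simp_all add: field_simps)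

text \<open>The entries of \<open>Delta_mn\<close> are twice the nodes. The resulting powers of 2
  are those produced by the factors \<open>(2 / x) ^ p\<close> of the Wronskian.\<close>

lemma Delta_mn_eq:
  "Delta_mn b ms ns = (\<Prod>p<length ms + length ns. 2 ^ p)
     * vandermonde (length ms + length ns) (beads (length ms) ((!) (ms @ ns)) b)"
proof -
  let ?n = "length ms + length ns" and ?z = "beads (length ms) ((!) (ms @ ns)) b"
  let ?v = "map (\<lambda>m. 2 * of_nat m + b) ms @ map (\<lambda>n. 2 * of_nat n - b) ns"
  have v: "?v ! j = 2 * ?z j" if "j < ?n" for j
    using that by (auto simp: nth_append beads_def algebra_simps)
  have "Delta_mn b ms ns = (\<Prod>j<?n. \<Prod>i<j. 2 * (?z j - ?z i))"
    unfolding Delta_mn_def vdm_def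
    by (intro prod.cong) (auto simp: v right_diff_distrib)
  also have "\<dots> = (\<Prod>j<?n. 2 ^ j * (\<Prod>i<j. ?z j - ?z i))"
    by (simp only: prod.distrib prod_constant card_lessThan)
  finally show ?thesis by (simp only: prod.distrib vandermonde_def)
qed

lemma beads_inj:
  assumes "distinct ms" "distinct ns" "b \<notin> \<int>"
  shows "inj_on (beads (length ms) ((!) (ms @ ns)) b) {..<length ms + length ns}"
proof (rule inj_onI)
  let ?r = "length ms"
  have b: "b \<noteq> of_nat i - of_nat j" "- b \<noteq> of_nat i - of_nat j" for i j
  proof -
    show *: "b \<noteq> of_nat i - of_nat j" for i j using assms(3) by auto
    show "- b \<noteq> of_nat i - of_nat j"
      using *[of j i] by (metis minus_diff_eq minus_minus)
  qed
  fix i j assume ij: "i \<in> {..<?r + length ns}" "j \<in> {..<?r + length ns}"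
    and eq: "beads ?r ((!) (ms @ ns)) b i = beads ?r ((!) (ms @ ns)) b j"
  consider "i < ?r" "j < ?r" | "i < ?r" "\<not> j < ?r" | "\<not> i < ?r" "j < ?r" | "\<not> i < ?r" "\<not> j < ?r"
    by blast
  then show "i = j"
  proof cases
    case 1
    then show ?thesis using eq assms(1) by (simp add: beads_def nth_append nth_eq_iff_index_eq)
  next
    case 2
    then have "b = of_nat (ns ! (j - ?r)) - of_nat (ms ! i)"
      using eq by (simp add: beads_def nth_append algebra_simps)
    then show ?thesis using b by blast
  next
    case 3
    then have "- b = of_nat (ms ! j) - of_nat (ns ! (i - ?r))"
      using eq by (simp add: beads_def nth_append algebra_simps)
    then show ?thesis using b by blast
  next
    case 4
    then show ?thesis using eq assms(2) ij by (simp add: beads_def nth_append nth_eq_iff_index_eq)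
  qed
qed

lemma infinite_not_Ints: "infinite {b :: complex. b \<notin> \<int>}"
proof
  assume "finite {b :: complex. b \<notin> \<int>}"
  then have "finite (range (\<lambda>k. of_nat k + \<i>))"
    by (rule finite_subset[rotated]) (auto simp: complex_is_Int_iff)
  then show False
    using finite_imageD[of "\<lambda>k. of_nat k + \<i>" UNIV] by (auto simp: inj_def)
qed

text \<open>This transfers identities from non-integral parameters, where all nodes are distinct, to
  every parameter.\<close>

lemma poly_eq_off_Ints:
  fixes p q :: "complex poly"
  assumes "\<And>b. b \<notin> \<int> \<Longrightarrow> poly p b = poly q b"
  shows "p = q"
proof (rule ccontr)
  assume "p \<noteq> q"
  then have "finite {b. poly (p - q) b = 0}" by (intro poly_roots_finite) simp
  moreover have "{b. b \<notin> \<int>} \<subseteq> {b. poly (p - q) b = 0}" using assms by auto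
  ultimately show False using infinite_not_Ints finite_subset by blast
qed

text \<open>\<open>lag_det_beads_polynomial\<close> supplies the coefficients and
  \<open>lag_quot_beads_eq_0\<close> the degree bound. The family so obtained satisfies the definite
  description and is its only solution.\<close>

lemma Phi_tilde_polynomial:
  fixes ms ns :: "nat list"
  assumes dist: "distinct ms" "distinct ns"
    and d: "sum_list ms + sum_list ns = d + \<Sum>{..<length ms} + \<Sum>{..<length ns}"
  obtains G :: "nat \<Rightarrow> complex poly"
  where "\<And>b. Phi_tilde ms ns b = (\<Sum>k\<le>d. monom (poly (G k) b) (d - k))"
    and "\<And>b k. b \<notin> \<int> \<Longrightarrow> poly (G k) b
       = lag_quot ((b / 2)\<^sup>2) (length ms + length ns) (beads (length ms) ((!) (ms @ ns)) b) k"
proof -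
  let ?r = "length ms" and ?s = "length ns"
  let ?n = "?r + ?s" and ?m = "(!) (ms @ ns)"
  let ?z = "beads ?r ?m"
  obtain G where G: "\<And>b k. fps_nth (lag_det ((b / 2)\<^sup>2) ?n (?z b)) k = poly (G k) b * vandermonde ?n (?z b)"
    by (rule lag_det_beads_polynomial[of ?n ?r ?m], rule that)
  have Gq: "poly (G k) b = lag_quot ((b / 2)\<^sup>2) ?n (?z b) k" if "b \<notin> \<int>" for b k
    using G[of b k] beads_inj[OF dist that] by (simp add: lag_quot_def vandermonde_nonzero_iff)
  have summ: "(\<Sum>j<?n. ?m j) = sum_list ms + sum_list ns"
    using sum_list_sum_nth[of "ms @ ns"] by (simp add: atLeast0LessThan)
  have G0: "G k = 0" if "d < k" for k
  proof (rule poly_eq_off_Ints)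
    fix b :: complex assume b: "b \<notin> \<int>"
    show "poly (G k) b = poly 0 b"
      unfolding Gq[OF b] by (subst lag_quot_beads_eq_0) (use that summ d beads_inj[OF dist b] in auto)
  qed
  define F where "F b = (\<Sum>k\<le>d. monom (poly (G k) b) (d - k))" for b
  \<comment> \<open>The relation is proved for every \<open>b\<close>: the identity defining
    \<open>G\<close> has the Vandermonde factor on the right and holds at its zeros too.\<close>
  have rel: "Phi_tilde_rel ms ns b (F b)" for b
    unfolding Phi_tilde_rel_def
  proof (intro allI impI)
    fix x :: real assume x: "x > 0"
    let ?x = "of_real x :: complex"
    have x0: "?x \<noteq> 0" using x by simp
    define V where "V = vandermonde ?n (?z b)"
    define P where "P = det (mat ?n ?n (\<lambda>(j,p). lag_poly ((b / 2)\<^sup>2) (?z b j) (?m j) p))"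
    have cP: "coeff P k = poly (G k) b * V" for k
      using G[of b k] unfolding lag_det_eq_fps_of_poly P_def V_def by simp
    have "degree P \<le> d" by (rule degree_le) (simp add: cP G0)
    then have "poly P (1 / ?x\<^sup>2) = (\<Sum>k\<le>d. coeff P k * (1 / ?x\<^sup>2) ^ k)"
      unfolding poly_altdef by (intro sum.mono_neutral_left) (auto simp: coeff_eq_0)
    also have "\<dots> = V * (\<Sum>k\<le>d. poly (G k) b * (?x\<^sup>2) ^ (d - k)) / (?x\<^sup>2) ^ d"
      unfolding sum_distrib_left sum_divide_distrib
      by (intro sum.cong refl) (use x0 in \<open>simp add: cP power_diff power_one_over field_simps\<close>)
    also have "(\<Sum>k\<le>d. poly (G k) b * (?x\<^sup>2) ^ (d - k)) = poly (F b) (?x\<^sup>2)"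
      by (simp add: F_def poly_sum poly_monom)
    finally have P: "poly P (1 / ?x\<^sup>2) = V * poly (F b) (?x\<^sup>2) / (?x\<^sup>2) ^ d" .
    have pw: "?x ^ k = ?x powr of_nat k" for k
      using x0 by (simp add: powr_nat')
    have p2: "(?x\<^sup>2) ^ d = ?x powr of_nat (2 * d)"
      using pw[of "2 * d"] by (simp only: power_mult)
    have sumz: "(\<Sum>j<?n. 2 * ?z b j) = 2 * of_nat (sum_list ms + sum_list ns) + b * (of_nat ?r - of_nat ?s)"
    proof -
      have "(\<Sum>j<?n. 2 * ?z b j) = 2 * of_nat (\<Sum>j<?n. ?m j) + (\<Sum>j<?n. if j < ?r then b else - b)"
        unfolding of_nat_sum sum_distrib_left sum.distrib[symmetric]
        by (intro sum.cong refl) (simp add: beads_def)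
      also have "(\<Sum>j<?n. if j < ?r then b else - b) = (\<Sum>j<?r. b) + (\<Sum>j=?r..<?n. - b)"
      proof -
        have "{..<?n} \<inter> {j. j < ?r} = {..<?r}" "{..<?n} \<inter> - {j. j < ?r} = {?r..<?n}" by auto
        then show ?thesis by (simp only: sum.If_cases finite_lessThan)
      qed
      finally show ?thesis by (simp add: summ algebra_simps)
    qed
    have "(\<Prod>p<?n. exp (- ?x\<^sup>2 / 2) * ?x powr (1/2) * (2 / ?x) ^ p)
        = exp (- ?x\<^sup>2 / 2) ^ ?n * (?x powr (1/2)) ^ ?n * ((\<Prod>p<?n. 2 ^ p) / ?x ^ (\<Sum>{..<?n}))"
      by (simp add: prod.distrib power_divide prod_dividef power_sum power_mult_distrib)
    also have "(?x powr (1/2)) ^ ?n = ?x powr (of_nat ?n / 2)"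
      using x0 by (simp add: powr_def exp_of_nat_mult[symmetric])
    also have "exp (- ?x\<^sup>2 / 2) ^ ?n = exp (- of_nat ?n * ?x\<^sup>2 / 2)"
      by (simp only: exp_of_nat_mult[symmetric] mult_minus_left mult_minus_right times_divide_eq_right)
    finally have pre: "(\<Prod>p<?n. exp (- ?x\<^sup>2 / 2) * ?x powr (1/2) * (2 / ?x) ^ p)
        = exp (- of_nat ?n * ?x\<^sup>2 / 2) * ?x powr (of_nat ?n / 2) * ((\<Prod>p<?n. 2 ^ p) / ?x ^ (\<Sum>{..<?n}))" .
    have "(\<Prod>j<?n. ?x powr (2 * ?z b j)) = ?x powr (\<Sum>j<?n. 2 * ?z b j)"
      using x0 by (simp add: powr_def exp_sum sum_distrib_right)
    then have "?x powr (of_nat ?n / 2) / ?x ^ (\<Sum>{..<?n}) * (\<Prod>j<?n. ?x powr (2 * ?z b j)) / (?x\<^sup>2) ^ d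
        = ?x powr (of_nat ?n / 2 - of_nat (\<Sum>{..<?n}) + (\<Sum>j<?n. 2 * ?z b j) - of_nat (2 * d))"
      by (simp only: p2 pw[of "\<Sum>{..<?n}"] powr_add powr_diff)
    \<comment> \<open>With \<open>d\<close> substituted, the part without \<open>b\<close> becomes
      \<open>r^2 + s^2 - (r + s)^2 / 2 = (r - s)^2 / 2\<close>.\<close>
    also have "of_nat ?n / 2 - of_nat (\<Sum>{..<?n}) + (\<Sum>j<?n. 2 * ?z b j) - of_nat (2 * d)
        = of_int ((int ?r - int ?s)\<^sup>2) / 2 + b * of_int (int ?r - int ?s)"
      unfolding sumz d of_nat_add of_nat_sum_lessThan
      by (simp add: power2_eq_square field_simps)
    finally have E: "?x powr (of_nat ?n / 2) / ?x ^ (\<Sum>{..<?n}) * (\<Prod>j<?n. ?x powr (2 * ?z b j)) / (?x\<^sup>2) ^ d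
        = ?x powr (of_int ((int ?r - int ?s)\<^sup>2) / 2 + b * of_int (int ?r - int ?s))" .
    show "Psi b ms ns ?x = Delta_mn b ms ns * exp (- of_nat ?n * ?x\<^sup>2 / 2)
        * ?x powr (of_int ((int ?r - int ?s)\<^sup>2) / 2 + b * of_int (int ?r - int ?s)) * poly (F b) (?x\<^sup>2)"
      unfolding Psi_eq[OF x] pre P_def[symmetric] P Delta_mn_eq V_def[symmetric] E[symmetric]
      by (simp add: mult_ac)
  qed
  have "Phi_tilde ms ns = F"
    unfolding Phi_tilde_def
  proof (rule the_equality)
    show "(\<forall>k. \<exists>q. \<forall>b. coeff (F b) k = poly q b) \<and> (\<forall>b. Delta_mn b ms ns \<noteq> 0 \<longrightarrow> Phi_tilde_rel ms ns b (F b))"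
    proof (intro conjI allI impI)
      fix k
      have "coeff (F b) k = poly (\<Sum>i\<le>d. if d - i = k then G i else 0) b" for b
        unfolding F_def coeff_sum poly_sum by (intro sum.cong refl) simp
      then show "\<exists>q. \<forall>b. coeff (F b) k = poly q b" by blast
    qed (rule rel)
  next
    fix F' assume F': "(\<forall>k. \<exists>q. \<forall>b. coeff (F' b) k = poly q b)
        \<and> (\<forall>b. Delta_mn b ms ns \<noteq> 0 \<longrightarrow> Phi_tilde_rel ms ns b (F' b))"
    \<comment> \<open>Here the prefactors are nonzero, so both polynomials agree at the infinitely
      many squares of positive reals.\<close>
    have eq: "F' b = F b" if b: "b \<notin> \<int>" for b
    proof -
      have D: "Delta_mn b ms ns \<noteq> 0"
        unfolding Delta_mn_eq using beads_inj[OF dist b] by (simp add: vandermonde_nonzero_iff)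
      then have rel': "Phi_tilde_rel ms ns b (F' b)" using F' by blast
      have "poly (F' b) ((of_real x)\<^sup>2) = poly (F b) ((of_real x)\<^sup>2)" if "x > 0" for x :: real
        using rel' rel[of b] D that unfolding Phi_tilde_rel_def by simp
      then have "(\<lambda>x. (of_real x)\<^sup>2) ` {0<..} \<subseteq> {y. poly (F' b - F b) y = 0}" by auto
      moreover have "infinite ((\<lambda>x. (of_real x :: complex)\<^sup>2) ` {0<..})"
      proof
        assume "finite ((\<lambda>x. (of_real x :: complex)\<^sup>2) ` {0<..})"
        moreover have "inj_on (\<lambda>x. (of_real x :: complex)\<^sup>2) {0<..}"
          by (auto simp: inj_on_def power2_eq_iff simp flip: of_real_minus)
        ultimately have "finite {0 :: real<..}" by (rule finite_imageD)
        then show False by (simp add: infinite_Ioi)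
      qed
      ultimately have "infinite {y. poly (F' b - F b) y = 0}" using finite_subset by blast
      then show ?thesis using poly_roots_finite[of "F' b - F b"] by auto
    qed
    show "F' = F"
    proof (rule ext, rule poly_eqI)
      fix b k
      obtain q where q: "\<And>b. coeff (F' b) k = poly q b" using F' by blast
      have F: "coeff (F b) k = poly (\<Sum>i\<le>d. if d - i = k then G i else 0) b" for b
        unfolding F_def coeff_sum poly_sum by (intro sum.cong refl) simp
      have "q = (\<Sum>i\<le>d. if d - i = k then G i else 0)"
      proof (rule poly_eq_off_Ints)
        fix b :: complex assume "b \<notin> \<int>"
        from eq[OF this] show "poly q b = poly (\<Sum>i\<le>d. if d - i = k then G i else 0) b"
          using q[of b] F[of b] by (simp only:)
      qed
      then show "coeff (F' b) k = coeff (F b) k" by (simp only: q F)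
    qed
  qed
  then show thesis
    using that[of G] Gq unfolding F_def by simp
qed

section \<open>Conjugate partitions\<close>

text \<open>In a decreasing list the entries above \<open>j\<close> form an initial segment.\<close>

lemma less_length_filter_iff:
  assumes "sorted_wrt (\<ge>) la"
  shows "i < length (filter (\<lambda>x. Suc j \<le> x) la) \<longleftrightarrow> i < length la \<and> j < la ! i"
  using assms
proof (induction la arbitrary: i)
  case (Cons a la)
  show ?case
  proof (cases "j < a")
    case True
    then show ?thesis using Cons by (cases i) auto
  next
    case False
    then have "filter (\<lambda>x. Suc j \<le> x) (a # la) = []"
      using Cons.prems by (auto simp: filter_empty_conv)
    moreover have "\<not> j < (a # la) ! i" if "i < length (a # la)"
      using False Cons.prems that nth_mem[OF that] by auto
    ultimately show ?thesis by auto
  qed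
qed simp

lemma less_foldr_max_iff: "j < foldr max la (0 :: nat) \<longleftrightarrow> (\<exists>x\<in>set la. j < x)"
  by (induction la) (auto simp: less_max_iff_disj)

lemma length_part_conj: "length (part_conj la) = foldr max la 0"
  by (simp add: part_conj_def)

text \<open>Transposition of the Young diagram, box by box; the order and involution properties of
  \<open>part_conj\<close> are derived from it.\<close>

lemma less_part_conj_iff:
  assumes "is_partition la" "j < length (part_conj la)"
  shows "i < part_conj la ! j \<longleftrightarrow> i < length la \<and> j < la ! i"
  using assms less_length_filter_iff[of la i j]
  by (simp add: part_conj_def is_partition_def)

lemma is_partition_part_conj:
  assumes "is_partition la"
  shows "is_partition (part_conj la)"
proof -
  have "part_conj la ! j \<le> part_conj la ! i" if "i < j" "j < length (part_conj la)" for i j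
  proof -
    have "x < part_conj la ! i" if "x < part_conj la ! j" for x
      using that \<open>i < j\<close> \<open>j < length (part_conj la)\<close> assms by (simp add: less_part_conj_iff)
    then show ?thesis by (meson leI less_irrefl)
  qed
  moreover have "0 < part_conj la ! j" if j: "j < length (part_conj la)" for j
  proof -
    obtain x where "x \<in> set la" "j < x"
      using j by (auto simp: length_part_conj less_foldr_max_iff)
    then obtain i where "i < length la" "j < la ! i" by (auto simp: in_set_conv_nth)
    then have "i < part_conj la ! j" using assms j by (simp add: less_part_conj_iff)
    then show ?thesis by simp
  qed
  ultimately show ?thesis
    unfolding is_partition_def sorted_wrt_iff_nth_less by (auto simp: in_set_conv_nth)
qed

lemma nth_less_length_part_conj: "i < length la \<Longrightarrow> la ! i \<le> length (part_conj la)"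
  using less_foldr_max_iff[of _ la] nth_mem[of i la] unfolding length_part_conj by (meson leI less_irrefl)

lemma length_part_conj_part_conj:
  assumes "is_partition la"
  shows "length (part_conj (part_conj la)) = length la"
proof -
  have "j < foldr max (part_conj la) 0 \<longleftrightarrow> j < length la" for j
  proof -
    have "j < foldr max (part_conj la) 0 \<longleftrightarrow> (\<exists>k<length (part_conj la). j < part_conj la ! k)"
      unfolding less_foldr_max_iff by (metis in_set_conv_nth)
    also have "\<dots> \<longleftrightarrow> (\<exists>k<length (part_conj la). j < length la \<and> k < la ! j)"
      using less_part_conj_iff[OF assms] by auto
    also have "\<dots> \<longleftrightarrow> j < length la"
    proof
      assume "j < length la"
      moreover from this have "0 < la ! j" using assms by (auto simp: is_partition_def)
      ultimately show "\<exists>k<length (part_conj la). j < length la \<and> k < la ! j"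
        using nth_less_length_part_conj[of j la] by (intro exI[of _ 0]) auto
    qed auto
    finally show ?thesis .
  qed
  then show ?thesis unfolding length_part_conj by (meson leI less_irrefl order_antisym)
qed

lemma part_conj_part_conj:
  assumes "is_partition la"
  shows "part_conj (part_conj la) = la"
proof (rule nth_equalityI)
  show len: "length (part_conj (part_conj la)) = length la"
    by (rule length_part_conj_part_conj[OF assms])
  fix i assume i: "i < length (part_conj (part_conj la))"
  have "k < part_conj (part_conj la) ! i \<longleftrightarrow> k < la ! i" for k
    using i len nth_less_length_part_conj[of i la] less_part_conj_iff[OF assms, of k i]
    by (auto simp: less_part_conj_iff[OF is_partition_part_conj[OF assms] i])
  then show "part_conj (part_conj la) ! i = la ! i" by (meson leI less_irrefl order_antisym)
qed

text \<open>The boxes are counted by columns instead of rows.\<close>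

lemma part_size_part_conj: "part_size (part_conj la) = part_size la"
proof -
  have "(\<Sum>j<n. length (filter (\<lambda>x. Suc j \<le> x) la)) = sum_list la" if "\<forall>x\<in>set la. x \<le> n" for n
    using that
  proof (induction la)
    case (Cons a la)
    have "(\<Sum>j<n. length (filter (\<lambda>x. Suc j \<le> x) (a # la)))
        = (\<Sum>j<n. (if j < a then 1 else 0) + length (filter (\<lambda>x. Suc j \<le> x) la))"
      by (intro sum.cong) auto
    also have "\<dots> = card ({..<n} \<inter> {j. j < a}) + sum_list la"
      using Cons by (simp add: sum.distrib sum.If_cases)
    also have "{..<n} \<inter> {j. j < a} = {..<a}" using Cons.prems by auto
    finally show ?case by simp
  qed simp
  moreover have "\<forall>x\<in>set la. x \<le> foldr max la 0"
    using less_foldr_max_iff[of _ la] by (meson leI less_irrefl)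
  ultimately show ?thesis
    by (simp add: part_size_def part_conj_def interv_sum_list_conv_sum_set_nat atLeast0LessThan)
qed

lemma length_add_staircase [simp]: "length (add_staircase la) = length la"
  by (simp add: add_staircase_def)

lemma nth_add_staircase: "i < length la \<Longrightarrow> add_staircase la ! i = la ! i + (length la - 1 - i)"
  by (simp add: add_staircase_def rev_nth)

lemma sum_list_add_staircase: "sum_list (add_staircase la) = part_size la + \<Sum>{..<length la}"
proof -
  have "sum_list (add_staircase la) = (\<Sum>i<length la. la ! i + (length la - Suc i))"
    by (simp add: sum_list_sum_nth atLeast0LessThan nth_add_staircase)
  also have "\<dots> = (\<Sum>i<length la. la ! i) + (\<Sum>i<length la. length la - Suc i)"
    by (rule sum.distrib)
  also have "(\<Sum>i<length la. length la - Suc i) = \<Sum>{..<length la}"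
    by (rule sum.nat_diff_reindex)
  finally show ?thesis
    by (simp add: part_size_def sum_list_sum_nth atLeast0LessThan)
qed

lemma distinct_add_staircase:
  assumes "is_partition la"
  shows "distinct (add_staircase la)"
proof -
  have "add_staircase la ! j < add_staircase la ! i" if "i < j" "j < length la" for i j
  proof -
    have "la ! j \<le> la ! i" using assms that by (auto simp: is_partition_def sorted_wrt_iff_nth_less)
    then show ?thesis using that by (simp add: nth_add_staircase)
  qed
  then show ?thesis
    unfolding distinct_conv_nth by (metis length_add_staircase less_irrefl linorder_neqE_nat)
qed

lemma set_add_staircase_subset:
  "set (add_staircase la) \<subseteq> {..<length la + length (part_conj la)}"
proof
  fix x assume "x \<in> set (add_staircase la)"
  then obtain i where i: "i < length la" "x = add_staircase la ! i"
    by (auto simp: in_set_conv_nth)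
  then show "x \<in> {..<length la + length (part_conj la)}"
    using nth_less_length_part_conj[of i la] by (simp add: nth_add_staircase)
qed

lemma image_reflect: "A \<subseteq> {..<M :: nat} \<Longrightarrow> (\<lambda>m. M - 1 - m) ` (\<lambda>m. M - 1 - m) ` A = A"
  unfolding image_image by (rule image_cong[THEN trans, OF refl _ image_ident]) auto

text \<open>In the bead encoding, conjugation exchanges beads and gaps and reverses the order.\<close>

lemma set_add_staircase_part_conj:
  assumes p: "is_partition la" and M: "M = length la + length (part_conj la)"
  shows "set (add_staircase (part_conj la)) = (\<lambda>m. M - 1 - m) ` ({..<M} - set (add_staircase la))"
proof -
  let ?X = "set (add_staircase la)" and ?X' = "set (add_staircase (part_conj la))"
  let ?f = "\<lambda>m. M - 1 - m"
  have X: "?X \<subseteq> {..<M}" using set_add_staircase_subset[of la] M by simp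
  have X': "?X' \<subseteq> {..<M}"
    using set_add_staircase_subset[of "part_conj la"] M length_part_conj_part_conj[OF p] by auto
  have inj: "inj_on ?f {..<M}" by (auto simp: inj_on_def)
  \<comment> \<open>A common point would give \<open>la ! i + part_conj la ! j = i + j + 1\<close>.
    But \<open>j < la ! i\<close> holds exactly when \<open>i < part_conj la ! j\<close>, so this
    sum is at least \<open>i + j + 2\<close> or at most \<open>i + j\<close>.\<close>
  have "?f y \<notin> ?X" if y: "y \<in> ?X'" for y
  proof
    assume "?f y \<in> ?X"
    then obtain i where i: "i < length la" "?f y = la ! i + (length la - 1 - i)"
      by (auto simp: in_set_conv_nth nth_add_staircase)
    obtain j where j: "j < length (part_conj la)" "y = part_conj la ! j + (length (part_conj la) - 1 - j)"
      using y by (auto simp: in_set_conv_nth nth_add_staircase)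
    have "y < M" using y X' by auto
    show False
    proof (cases "j < la ! i")
      case True
      then have "i < part_conj la ! j" using p i j by (simp add: less_part_conj_iff)
      then show False using True i j M \<open>y < M\<close> by linarith
    next
      case False
      then have "part_conj la ! j \<le> i" using p i j less_part_conj_iff[OF p j(1), of i] by auto
      then show False using False i j M \<open>y < M\<close> by linarith
    qed
  qed
  then have sub: "?f ` ?X' \<subseteq> {..<M} - ?X" using X' by auto
  have "card (?f ` ?X') = length (part_conj la)"
    using inj_on_subset[OF inj X'] distinct_add_staircase[OF is_partition_part_conj[OF p]]
    by (simp add: card_image distinct_card)
  moreover have "card ({..<M} - ?X) = M - length la"
    using X distinct_add_staircase[OF p] by (simp add: card_Diff_subset distinct_card)
  ultimately have "?f ` ?X' = {..<M} - ?X"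
    using sub M by (intro card_subset_eq) auto
  then show ?thesis using image_reflect[OF X'] by simp
qed

lemma beads_image:
  "beads (length ms) ((!) (ms @ ns)) b ` {..<length ms + length ns}
     = (\<lambda>m. b / 2 + of_nat m) ` set ms \<union> (\<lambda>m. - (b / 2) + of_nat m) ` set ns"
proof -
  let ?r = "length ms" and ?s = "length ns"
  let ?z = "beads ?r ((!) (ms @ ns)) b"
  have ms: "set ms = (!) ms ` {..<?r}" and ns: "set ns = (!) ns ` {..<?s}"
    by (auto simp: set_conv_nth)
  have "{..<?r + ?s} = {..<?r} \<union> {?r..<?r + ?s}" by auto
  also have "{?r..<?r + ?s} = (+) ?r ` {..<?s}"
    by (simp add: lessThan_atLeast0 image_add_atLeastLessThan add.commute)
  finally have "?z ` {..<?r + ?s} = ?z ` {..<?r} \<union> (\<lambda>i. ?z (?r + i)) ` {..<?s}"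
    by (simp only: image_Un image_image)
  also have "?z ` {..<?r} = (\<lambda>m. b / 2 + of_nat m) ` set ms"
    unfolding ms image_image by (rule image_cong) (auto simp: beads_def nth_append)
  also have "(\<lambda>i. ?z (?r + i)) ` {..<?s} = (\<lambda>m. - (b / 2) + of_nat m) ` set ns"
    unfolding ns image_image by (rule image_cong) (auto simp: beads_def)
  finally show ?thesis .
qed

text \<open>Non-integral \<open>2 * e\<close> makes the two chains disjoint, so the complement can
  be taken in each separately.\<close>

lemma chain_shift_Diff:
  assumes "2 * e \<notin> \<int>" "X \<subseteq> {..<M}" "Y \<subseteq> {..<L}"
  shows "chain (- e) M \<union> chain e L - ((\<lambda>m. e + of_nat m) ` Y \<union> (\<lambda>m. - e + of_nat m) ` X)
       = (\<lambda>m. - e + of_nat m) ` ({..<M} - X) \<union> (\<lambda>m. e + of_nat m) ` ({..<L} - Y)"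
proof -
  have ne: "e + of_nat i \<noteq> - e + of_nat j" for i j
  proof
    assume "e + of_nat i = - e + of_nat j"
    then have "2 * e = of_nat j - of_nat i" by (simp add: algebra_simps)
    then show False using assms(1) by auto
  qed
  let ?f = "\<lambda>m. - e + of_nat m" and ?g = "\<lambda>m. e + of_nat m"
  have disj: "?f ` A \<inter> ?g ` B = {}" for A B
  proof (rule Int_emptyI)
    fix x assume "x \<in> ?f ` A" "x \<in> ?g ` B"
    then obtain i j where "x = ?f i" "x = ?g j" by blast
    then have "?g j = ?f i" by (simp only:)
    with ne show False by blast
  qed
  have "P \<union> Q - (Q1 \<union> P1) = (P - P1) \<union> (Q - Q1)" if "P \<inter> Q1 = {}" "P1 \<inter> Q = {}"
    for P P1 Q Q1 :: "complex set"
    using that by blast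
  from this[OF disj disj]
  have "?f ` {..<M} \<union> ?g ` {..<L} - (?g ` Y \<union> ?f ` X) = (?f ` {..<M} - ?f ` X) \<union> (?g ` {..<L} - ?g ` Y)" .
  also have "\<dots> = ?f ` ({..<M} - X) \<union> ?g ` ({..<L} - Y)"
    by (subst (1 2) image_set_diff) (auto simp: inj_def)
  finally show ?thesis unfolding chain_def .
qed

text \<open>Both sides have the coefficients of \<open>Phi_tilde_polynomial\<close>. At non-integral
  parameters the bead sets are reflected complements and \<open>lag_quot_dual\<close> applies;
  \<open>poly_eq_off_Ints\<close> gives the remaining parameters.\<close>

lemma Phi_conj:
  assumes la: "is_partition la" and mu: "is_partition mu"
  shows "poly (Phi (part_conj la) (part_conj mu) \<beta>) y
       = (-1) ^ (part_size la + part_size mu) * poly (Phi mu la \<beta>) (- y)"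
proof -
  define d where "d = part_size la + part_size mu"
  let ?la = "part_conj la" and ?mu = "part_conj mu"
  let ?ms1 = "add_staircase ?la" and ?ns1 = "add_staircase ?mu"
  let ?ms2 = "add_staircase mu" and ?ns2 = "add_staircase la"
  let ?n1 = "length ?la + length ?mu" and ?n2 = "length mu + length la"
  define M L where "M = length la + length ?la" and "L = length mu + length ?mu"
  \<comment> \<open>The parameter shifts in \<open>Phi\<close> on the two sides;
    \<open>c1 - c2 = L - M\<close> is what turns \<open>e\<close> into \<open>e'\<close> in the
    duality.\<close>
  define c1 c2 :: complex where "c1 = of_nat (length ?mu) - of_nat (length ?la)"
    and "c2 = of_nat (length la) - of_nat (length mu)"
  note dist = distinct_add_staircase[OF la] distinct_add_staircase[OF mu]
    distinct_add_staircase[OF is_partition_part_conj[OF la]] distinct_add_staircase[OF is_partition_part_conj[OF mu]]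
  obtain G1 where G1: "\<And>b. Phi_tilde ?ms1 ?ns1 b = (\<Sum>k\<le>d. monom (poly (G1 k) b) (d - k))"
    "\<And>b k. b \<notin> \<int> \<Longrightarrow> poly (G1 k) b = lag_quot ((b / 2)\<^sup>2) ?n1 (beads (length ?la) ((!) (?ms1 @ ?ns1)) b) k"
    by (rule Phi_tilde_polynomial[OF dist(3,4), of d])
      (simp_all add: d_def sum_list_add_staircase part_size_part_conj)
  obtain G2 where G2: "\<And>b. Phi_tilde ?ms2 ?ns2 b = (\<Sum>k\<le>d. monom (poly (G2 k) b) (d - k))"
    "\<And>b k. b \<notin> \<int> \<Longrightarrow> poly (G2 k) b = lag_quot ((b / 2)\<^sup>2) ?n2 (beads (length mu) ((!) (?ms2 @ ?ns2)) b) k"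
    by (rule Phi_tilde_polynomial[OF dist(2,1), of d])
      (simp_all add: d_def sum_list_add_staircase)
  have G: "poly (G1 k) (\<beta> + c1) = (-1) ^ k * poly (G2 k) (\<beta> + c2)" for k \<beta>
  proof -
    have "pcompose (G1 k) [:c1, 1:] = Polynomial.smult ((-1) ^ k) (pcompose (G2 k) [:c2, 1:])"
    proof (rule poly_eq_off_Ints)
      fix b :: complex assume b: "b \<notin> \<int>"
      have Ints: "b + (of_nat i - of_nat j) \<notin> \<int>" for i j :: nat
        using b Ints_diff[of "b + (of_nat i - of_nat j)" "of_nat i - of_nat j"] by auto
      have b1: "b + c1 \<notin> \<int>" and b2: "b + c2 \<notin> \<int>" unfolding c1_def c2_def by (rule Ints)+
      define e e' t :: complex where "e = (b + c2) / 2" and "e' = (b + c1) / 2" and "t = (of_nat M + of_nat L) / 2"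
      have e: "2 * e \<notin> \<int>" using b2 by (simp add: e_def del: distrib_left_numeral)
      have e': "e' = e + (of_nat L - of_nat M) / 2"
        by (simp add: e'_def e_def c1_def c2_def M_def L_def field_simps)
      let ?X = "set ?ns2" and ?Y = "set ?ms2"
      have X: "?X \<subseteq> {..<M}" and Y: "?Y \<subseteq> {..<L}"
        unfolding M_def L_def by (rule set_add_staircase_subset)+
      let ?z = "beads (length mu) ((!) (?ms2 @ ?ns2)) (b + c2)"
      let ?z' = "beads (length ?la) ((!) (?ms1 @ ?ns1)) (b + c1)"
      have Z: "?z ` {..<?n2} = (\<lambda>m. e + of_nat m) ` ?Y \<union> (\<lambda>m. - e + of_nat m) ` ?X"
        using beads_image[of ?ms2 ?ns2] by (simp add: e_def)
      have "?z' ` {..<?n1} = (\<lambda>m. e' + of_nat m) ` set ?ms1 \<union> (\<lambda>m. - e' + of_nat m) ` set ?ns1"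
        using beads_image[of ?ms1 ?ns1] by (simp add: e'_def)
      also have "(\<lambda>m. e' + of_nat m) ` set ?ms1 = (\<lambda>m. t - 1 - (- e + of_nat m)) ` ({..<M} - ?X)"
        unfolding set_add_staircase_part_conj[OF la M_def] image_image
        by (rule image_cong) (auto simp: of_nat_diff e' t_def field_simps)
      also have "(\<lambda>m. - e' + of_nat m) ` set ?ns1 = (\<lambda>m. t - 1 - (e + of_nat m)) ` ({..<L} - ?Y)"
        unfolding set_add_staircase_part_conj[OF mu L_def] image_image
        by (rule image_cong) (auto simp: of_nat_diff e' t_def field_simps)
      finally have Z': "?z' ` {..<?n1} = (\<lambda>c. t - 1 - c) ` (chain (- e) M \<union> chain e L - ?z ` {..<?n2})"
        unfolding Z chain_shift_Diff[OF e X Y] by (simp only: image_Un image_image)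
      have "lag_quot (e'\<^sup>2) ?n1 ?z' k = (-1) ^ k * lag_quot (e\<^sup>2) ?n2 ?z k"
      proof (rule lag_quot_dual[OF e refl t_def e' _ _ _ Z'])
        show "inj_on ?z {..<?n2}" using beads_inj[OF dist(2,1) b2] by simp
        show "inj_on ?z' {..<?n1}" using beads_inj[OF dist(3,4) b1] by simp
        show "?z ` {..<?n2} \<subseteq> chain (- e) M \<union> chain e L"
          unfolding Z chain_def using X Y by blast
      qed
      then show "poly (pcompose (G1 k) [:c1, 1:]) b = poly (Polynomial.smult ((-1) ^ k) (pcompose (G2 k) [:c2, 1:])) b"
        using G1(2)[OF b1] G2(2)[OF b2] by (simp add: poly_pcompose e_def e'_def add.commute)
    qed
    then have "poly (pcompose (G1 k) [:c1, 1:]) \<beta> = poly (Polynomial.smult ((-1) ^ k) (pcompose (G2 k) [:c2, 1:])) \<beta>"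
      by simp
    then show ?thesis by (simp add: poly_pcompose add.commute)
  qed
  have b: "\<beta> - of_nat (length ?la) + of_nat (length ?mu) = \<beta> + c1"
    "\<beta> - of_nat (length mu) + of_nat (length la) = \<beta> + c2"
    by (simp_all add: c1_def c2_def)
  have "poly (Phi ?la ?mu \<beta>) y = (\<Sum>k\<le>d. (-1) ^ k * poly (G2 k) (\<beta> + c2) * y ^ (d - k))"
    by (simp add: Phi_def b G1 poly_sum poly_monom G)
  \<comment> \<open>The sign \<open>(-1) ^ k\<close> is split as
    \<open>(-1) ^ d * (-1) ^ (d - k)\<close>, whose second factor turns \<open>y\<close> into
    \<open>- y\<close>.\<close>
  also have "\<dots> = (\<Sum>k\<le>d. (-1) ^ d * (poly (G2 k) (\<beta> + c2) * (- y) ^ (d - k)))"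
  proof (intro sum.cong refl)
    fix k assume "k \<in> {..d}"
    then have "(-1 :: complex) ^ d = (-1) ^ k * (-1) ^ (d - k)" by (simp flip: power_add)
    moreover have "(- y) ^ (d - k) = (-1) ^ (d - k) * y ^ (d - k)" by (rule power_minus)
    moreover have "(-1 :: complex) ^ (d - k) * (-1) ^ (d - k) = 1" by (simp flip: power_mult_distrib)
    ultimately show "(-1) ^ k * poly (G2 k) (\<beta> + c2) * y ^ (d - k)
        = (-1) ^ d * (poly (G2 k) (\<beta> + c2) * (- y) ^ (d - k))"
      by (simp add: mult_ac)
  qed
  also have "\<dots> = (-1) ^ d * poly (Phi mu la \<beta>) (- y)"
    by (simp add: Phi_def b G2 poly_sum poly_monom sum_distrib_left)
  finally show ?thesis unfolding d_def .
qed

theorem theorem3p1: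
  fixes la mu :: "nat list" and \<beta> :: complex
  assumes "is_partition la" and "is_partition mu"
  shows "(\<forall>y. poly (Phi (part_conj la) (part_conj mu) \<beta>) y
               = (-1) ^ (part_size la + part_size mu) * poly (Phi mu la \<beta>) (- y))
         \<and> (\<forall>y. poly (Phi la (part_conj la) \<beta>) (- y) = poly (Phi la (part_conj la) \<beta>) y)"
proof (intro conjI allI)
  fix y
  show "poly (Phi (part_conj la) (part_conj mu) \<beta>) y
      = (-1) ^ (part_size la + part_size mu) * poly (Phi mu la \<beta>) (- y)"
    by (rule Phi_conj[OF assms])
  \<comment> \<open>The duality is applied to the pair \<open>part_conj la\<close>,
    \<open>la\<close>; its sign exponent is twice the size of \<open>la\<close>, hence even.\<close>
  show "poly (Phi la (part_conj la) \<beta>) (- y) = poly (Phi la (part_conj la) \<beta>) y"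
    using Phi_conj[OF is_partition_part_conj[OF assms(1)] assms(1), of \<beta> y]
    by (simp add: part_conj_part_conj[OF assms(1)] part_size_part_conj)
qed

end
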